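(* Let $A$ and $B$ be two $n\times n$ positive definite matrices and let $0\le t\le 1$. Then for every $p>0$ and every unitarily invariant norm $|||\cdot|||$ on the space of $n\times n$ matrices, $$|||A\#_{t}B|||\leq |||e^{(1-t)\log A+t\log B}|||\leq \left|\left|\left|\left((1-t)A^{p}+t B^p\right)^{1/p}\right|\right|\right|.$$
   Context: Matrices are $n\times n$ (complex), and positive definite matrices are Hermitian. Real powers and logarithms of positive definite matrices are defined by the usual functional calculus. For $0\le t\le 1$ the $t$-geometric mean of positive definite $A,B$ is $A\#_tB=A^{1/2}\left(A^{-1/2}BA^{-1/2}\right)^tA^{1/2}$. A norm $|||\cdot|||$ on $n\times n$ matrices is unitarily invariant if $|||UXV|||=|||X|||$ for all matrices $X$ and all unitary $U,V$. *)

theory Defs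
  imports "HOL-Analysis.Analysis"
begin

definition adjoint_mat :: "complex^'n^'m \<Rightarrow> complex^'m^'n" where
  "adjoint_mat A = transpose (map_matrix cnj A)"

definition hermitian :: "complex^'n^'n \<Rightarrow> bool" where
  "hermitian A \<longleftrightarrow> adjoint_mat A = A"

definition unitary :: "complex^'n^'n \<Rightarrow> bool" where
  "unitary U \<longleftrightarrow> adjoint_mat U ** U = mat 1 \<and> U ** adjoint_mat U = mat 1"

text \<open>For Hermitian \<open>A\<close> the quadratic form below is real, so taking its real part loses nothing.\<close>

definition pos_def :: "complex^'n^'n \<Rightarrow> bool" where
  "pos_def A \<longleftrightarrow> hermitian A \<and>
     (\<forall>x. x \<noteq> 0 \<longrightarrow> 0 < Re (\<Sum>i\<in>UNIV. cnj (x $ i) * (A *v x) $ i))"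

definition diag_mat :: "('n \<Rightarrow> real) \<Rightarrow> complex^'n^'n" where
  "diag_mat d = (\<chi> i j. if i = j then complex_of_real (d i) else 0)"

text \<open>Functional calculus for Hermitian matrices: if \<open>A = U D U\<^sup>*\<close> with \<open>U\<close> unitary and
  \<open>D\<close> real diagonal, then \<open>f(A) = U f(D) U\<^sup>*\<close>. By the lemma \<open>matfun_eqI\<close> below, the result does
  not depend on the decomposition. The value is meaningful for Hermitian \<open>A\<close> only.\<close>

definition matfun :: "(real \<Rightarrow> real) \<Rightarrow> complex^'n^'n \<Rightarrow> complex^'n^'n" where
  "matfun f A = (THE X. \<exists>U d. unitary U \<and> A = U ** diag_mat d ** adjoint_mat U \<and>
                    X = U ** diag_mat (\<lambda>i. f (d i)) ** adjoint_mat U)"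

lemma matfun_eqI:
  fixes A :: "complex^'n^'n"
  assumes U: "unitary U" and A: "A = U ** diag_mat d ** adjoint_mat U"
  shows "matfun f A = U ** diag_mat (\<lambda>i. f (d i)) ** adjoint_mat U"
  unfolding matfun_def
proof (rule the_equality)
  show "\<exists>U' d'. unitary U' \<and> A = U' ** diag_mat d' ** adjoint_mat U' \<and>
          U ** diag_mat (\<lambda>i. f (d i)) ** adjoint_mat U =
          U' ** diag_mat (\<lambda>i. f (d' i)) ** adjoint_mat U'"
    using U A by blast
next
  fix X
  assume "\<exists>V e. unitary V \<and> A = V ** diag_mat e ** adjoint_mat V \<and>
            X = V ** diag_mat (\<lambda>i. f (e i)) ** adjoint_mat V"
  then obtain V e where V: "unitary V" and A': "A = V ** diag_mat e ** adjoint_mat V"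
    and X: "X = V ** diag_mat (\<lambda>i. f (e i)) ** adjoint_mat V" by blast
  define W where "W = adjoint_mat V ** U"
  have V1: "adjoint_mat V ** (V ** Y) = Y" "V ** (adjoint_mat V ** Y) = Y" for Y :: "complex^'n^'n"
    using V by (simp_all add: unitary_def matrix_mul_assoc)
  have U1: "adjoint_mat U ** (U ** Y) = Y" "U ** (adjoint_mat U ** Y) = Y"
    "adjoint_mat U ** U = mat 1" for Y :: "complex^'n^'n"
    using U by (simp_all add: unitary_def matrix_mul_assoc)
  have diag_l: "(diag_mat g ** M) $ i $ j = of_real (g i) * M $ i $ j"
    for g and M :: "complex^'n^'n" and i j
    by (simp add: matrix_matrix_mult_def diag_mat_def if_distrib if_distribR cong: if_cong)
  have diag_r: "(M ** diag_mat g) $ i $ j = M $ i $ j * of_real (g j)"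
    for g and M :: "complex^'n^'n" and i j
    by (simp add: matrix_matrix_mult_def diag_mat_def if_distrib if_distribR cong: if_cong)
  have "W ** diag_mat d = adjoint_mat V ** (U ** diag_mat d ** adjoint_mat U) ** U"
    using U by (simp add: W_def unitary_def flip: matrix_mul_assoc)
  also have "\<dots> = diag_mat e ** W"
    unfolding A[symmetric] A' by (simp add: W_def V1 flip: matrix_mul_assoc)
  finally have eq: "W ** diag_mat d = diag_mat e ** W" .
  have "W ** diag_mat (\<lambda>i. f (d i)) = diag_mat (\<lambda>i. f (e i)) ** W"
  proof (simp only: vec_eq_iff diag_l diag_r, intro allI)
    fix i j
    have "(W ** diag_mat d) $ i $ j = (diag_mat e ** W) $ i $ j"
      by (simp add: eq)
    then show "W $ i $ j * complex_of_real (f (d j)) = complex_of_real (f (e i)) * W $ i $ j"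
      by (auto simp: diag_l diag_r mult.commute)
  qed
  then have "V ** (W ** diag_mat (\<lambda>i. f (d i))) ** adjoint_mat U =
             V ** (diag_mat (\<lambda>i. f (e i)) ** W) ** adjoint_mat U" by simp
  then show "X = U ** diag_mat (\<lambda>i. f (d i)) ** adjoint_mat U"
    using U by (simp add: X W_def V1 unitary_def flip: matrix_mul_assoc)
qed

definition mat_powr :: "complex^'n^'n \<Rightarrow> real \<Rightarrow> complex^'n^'n" where
  "mat_powr A r = matfun (\<lambda>x. x powr r) A"

definition mat_ln :: "complex^'n^'n \<Rightarrow> complex^'n^'n" where
  "mat_ln A = matfun ln A"

text \<open>The type \<open>complex^'n^'n\<close> carries componentwise multiplication, so neither the library's
  \<open>^\<close> nor its \<open>exp\<close> is the matrix one; the powers are iterated by \<open>**\<close>.\<close>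

definition mat_exp :: "complex^'n^'n \<Rightarrow> complex^'n^'n" where
  "mat_exp A = (\<Sum>k. (1 / fact k) *\<^sub>R (((**) A) ^^ k) (mat 1))"

definition geom_mean :: "real \<Rightarrow> complex^'n^'n \<Rightarrow> complex^'n^'n \<Rightarrow> complex^'n^'n" where
  "geom_mean t A B =
     mat_powr A (1/2) ** mat_powr (mat_powr A (-1/2) ** B ** mat_powr A (-1/2)) t ** mat_powr A (1/2)"

definition matrix_norm :: "(complex^'n^'n \<Rightarrow> real) \<Rightarrow> bool" where
  "matrix_norm N \<longleftrightarrow>
     (\<forall>X. 0 \<le> N X) \<and> (\<forall>X. N X = 0 \<longleftrightarrow> X = 0) \<and>
     (\<forall>c X. N (map_matrix (\<lambda>z. c * z) X) = cmod c * N X) \<and>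
     (\<forall>X Y. N (X + Y) \<le> N X + N Y)"

definition unitarily_invariant_norm :: "(complex^'n^'n \<Rightarrow> real) \<Rightarrow> bool" where
  "unitarily_invariant_norm N \<longleftrightarrow>
     matrix_norm N \<and> (\<forall>U V X. unitary U \<longrightarrow> unitary V \<longrightarrow> N (U ** X ** V) = N X)"

end

theory Submission
  imports Defs
begin

text \<open>If \<open>H = U diag(h) U\<^sup>*\<close>
  and the sum of \<open>h\<close> over every set of largest entries is at most the corresponding sum of diagonal entries
  of \<open>U\<^sup>* K U\<close>, then scalar Jensen, pinching and Fan dominance for vectors give \<open>|||e\<^sup>H||| \<le> |||e\<^sup>K|||\<close>.

  The second inequality is then operator concavity of \<open>ln\<close>, applied to \<open>A\<^sup>p\<close> and \<open>B\<^sup>p\<close>. For the first, write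
  \<open>G\<close> for the geometric mean and \<open>A = G\<^bsup>1/2\<^esup> X G\<^bsup>1/2\<^esup>\<close>, \<open>B = G\<^bsup>1/2\<^esup> Y G\<^bsup>1/2\<^esup>\<close>, where \<open>(1 - t) ln X + t ln Y = 0\<close>.
  For a spectral projection \<open>P\<close> of \<open>G\<close> onto largest eigenvalues, Jensen's operator inequality for contractions
  gives \<open>tr P ln A \<ge> tr P ln G + tr P ln X\<close>, and likewise for \<open>B\<close>; the \<open>t\<close>-mean of the two is the
  hypothesis of the norm comparison.\<close>

section \<open>Unitary diagonalization\<close>

lemma adjoint_nth [simp]: "adjoint_mat A $ i $ j = cnj (A $ j $ i)"
  by (simp add: adjoint_mat_def transpose_def)

lemma adjoint_adjoint [simp]: "adjoint_mat (adjoint_mat A) = A"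
  by (simp add: vec_eq_iff)

lemma adjoint_mult: "adjoint_mat (A ** B) = adjoint_mat B ** adjoint_mat A"
  by (simp add: vec_eq_iff matrix_matrix_mult_def mult.commute)

lemma adjoint_add: "adjoint_mat (A + B) = adjoint_mat A + adjoint_mat B"
  by (simp add: vec_eq_iff)

lemma adjoint_scaleR: "adjoint_mat (c *\<^sub>R A) = c *\<^sub>R adjoint_mat A"
  by (simp add: vec_eq_iff)

lemma adjoint_diag_mat [simp]: "adjoint_mat (diag_mat d) = diag_mat d"
  by (simp add: vec_eq_iff diag_mat_def)

lemma mult_vec_scaleR: "A *v (c *\<^sub>R x) = c *\<^sub>R (A *v x)"
  and scaleR_mult_vec: "(c *\<^sub>R A) *v x = c *\<^sub>R (A *v x)"
  for A :: "complex^'n^'m"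
  by (simp_all add: vec_eq_iff matrix_vector_mult_def scaleR_sum_right)

text \<open>The real inner product of \<open>complex^'n\<close> is thus the real part of the
  Hermitian one. Quadratic forms are written with it throughout, so that they can be ordered and
  maximised as real quantities.\<close>

lemma inner_complex_eq: "inner z w = Re (cnj z * w)"
  by (simp add: inner_complex_def)

lemma inner_mult_adjoint:
  "inner x (A *v y) = inner (adjoint_mat A *v x) y"
proof -
  have "inner x (A *v y) = Re (\<Sum>i\<in>UNIV. \<Sum>j\<in>UNIV. cnj (x $ i) * (A $ i $ j * y $ j))"
    by (simp add: inner_vec_def inner_complex_eq matrix_vector_mult_def sum_distrib_left)
  also have "\<dots> = Re (\<Sum>j\<in>UNIV. \<Sum>i\<in>UNIV. cnj (x $ i) * (A $ i $ j * y $ j))"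
    by (subst sum.swap) simp
  also have "\<dots> = inner (adjoint_mat A *v x) y"
    unfolding inner_vec_def inner_complex_eq matrix_vector_mult_def Re_sum[symmetric]
    by (simp add: sum_distrib_right sum_distrib_left mult_ac del: Re_sum Im_sum times_complex.sel)
  finally show ?thesis .
qed

lemma pos_def_iff_inner:
  "pos_def A \<longleftrightarrow> hermitian A \<and> (\<forall>x. x \<noteq> 0 \<longrightarrow> 0 < inner x (A *v x))"
  by (simp add: pos_def_def inner_vec_def inner_complex_eq)

lemma diag_mult_nth [simp]: "(diag_mat d ** M) $ i $ j = of_real (d i) * M $ i $ j"
  and mult_diag_nth [simp]: "(M ** diag_mat d) $ i $ j = M $ i $ j * of_real (d j)"
  for M :: "complex^'n^'n"
  by (simp_all add: matrix_matrix_mult_def diag_mat_def if_distrib if_distribR cong: if_cong)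

lemma diag_vec_nth [simp]: "(diag_mat d *v x) $ i = of_real (d i) * x $ i"
  by (simp add: matrix_vector_mult_def diag_mat_def if_distrib if_distribR cong: if_cong)

lemma diag_mat_mult: "diag_mat d ** diag_mat e = (diag_mat (\<lambda>i. d i * e i) :: complex^'n^'n)"
  by (simp add: vec_eq_iff) (simp add: diag_mat_def)

lemma diag_mat_one: "diag_mat (\<lambda>_. 1) = mat 1"
  by (simp add: diag_mat_def mat_def vec_eq_iff)

lemma adjoint_one [simp]: "adjoint_mat (mat 1) = mat 1"
  by (simp add: vec_eq_iff mat_def)

lemma unitaryD:
  assumes "unitary U"
  shows "adjoint_mat U ** U = mat 1" "U ** adjoint_mat U = mat 1"
    "adjoint_mat U ** (U ** X) = X" "U ** (adjoint_mat U ** X) = X"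
    "X ** adjoint_mat U ** U = X" "X ** U ** adjoint_mat U = X"
    "adjoint_mat U *v (U *v x) = x" "U *v (adjoint_mat U *v x) = x"
  using assms by (simp_all add: unitary_def matrix_mul_assoc matrix_vector_mul_assoc)
    (simp_all flip: matrix_mul_assoc)

lemma unitaryI: "adjoint_mat U ** U = mat 1 \<Longrightarrow> unitary U"
  by (metis matrix_left_right_inverse unitary_def)

lemma unitary_mult: "unitary U \<Longrightarrow> unitary V \<Longrightarrow> unitary (U ** V)"
  by (intro unitaryI) (simp add: adjoint_mult unitaryD flip: matrix_mul_assoc)

lemma unitary_adjoint: "unitary U \<Longrightarrow> unitary (adjoint_mat U)"
  by (simp add: unitary_def)

lemma unitary_one: "unitary (mat 1)"
  by (simp add: unitary_def)

text \<open>The spectral form of a Hermitian matrix. For a fixed unitary \<open>U\<close>, sums,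
  products and \<open>matfun\<close> all act entrywise on \<open>d\<close>, which reduces most
  matrix identities below to scalar ones.\<close>

definition udiag :: "complex^'n^'n \<Rightarrow> ('n \<Rightarrow> real) \<Rightarrow> complex^'n^'n" where
  "udiag U d = U ** diag_mat d ** adjoint_mat U"

lemma matfun_udiag: "unitary U \<Longrightarrow> matfun f (udiag U d) = udiag U (\<lambda>i. f (d i))"
  using matfun_eqI[of U "udiag U d" d f] by (simp add: udiag_def)

lemma udiag_nth: "udiag U d $ i $ j = (\<Sum>l\<in>UNIV. of_real (d l) * (U $ i $ l * cnj (U $ j $ l)))"
  by (simp add: udiag_def matrix_matrix_mult_def[of "U ** _"] mult_ac)

lemma udiag_mult:
  "unitary U \<Longrightarrow> udiag U d ** udiag U e = udiag U (\<lambda>i. d i * e i)"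
  by (simp add: udiag_def unitaryD diag_mat_mult[symmetric] flip: matrix_mul_assoc)

lemma udiag_one: "unitary U \<Longrightarrow> udiag U (\<lambda>_. 1) = mat 1"
  by (simp add: udiag_def unitaryD diag_mat_one)

lemma udiag_add: "udiag U d + udiag U e = udiag U (\<lambda>i. d i + e i)"
  by (simp add: vec_eq_iff udiag_nth sum.distrib ring_distribs)

lemma udiag_scaleR: "c *\<^sub>R udiag U d = udiag U (\<lambda>i. c * d i)"
  by (simp add: vec_eq_iff udiag_nth scaleR_conv_of_real[where 'a=complex] sum_distrib_left mult_ac)

lemma udiag_conj: "V ** udiag U d ** adjoint_mat V = udiag (V ** U) d"
  by (simp add: udiag_def adjoint_mult matrix_mul_assoc)

lemma udiag_conj': "adjoint_mat V ** udiag U d ** V = udiag (adjoint_mat V ** U) d"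
  using udiag_conj[of "adjoint_mat V" U d] by simp

lemma udiag_mat_1: "udiag (mat 1) d = diag_mat d"
  by (simp add: udiag_def)

lemma adjoint_udiag [simp]: "adjoint_mat (udiag U d) = udiag U d"
  by (simp add: udiag_def adjoint_mult matrix_mul_assoc)

lemma hermitian_udiag: "hermitian (udiag U d)"
  by (simp add: hermitian_def)

lemma inner_udiag:
  "inner x (udiag U d *v x) = (\<Sum>i\<in>UNIV. d i * (cmod ((adjoint_mat U *v x) $ i))\<^sup>2)"
proof -
  have "inner x (udiag U d *v x) = inner (adjoint_mat U *v x) (diag_mat d *v (adjoint_mat U *v x))"
    by (simp add: udiag_def inner_mult_adjoint flip: matrix_vector_mul_assoc)
  also have "\<dots> = (\<Sum>i\<in>UNIV. d i * (cmod ((adjoint_mat U *v x) $ i))\<^sup>2)"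
    unfolding inner_vec_def
    by (intro sum.cong refl) (simp add: inner_complex_def cmod_power2, simp add: power2_eq_square algebra_simps)
  finally show ?thesis .
qed

lemma sum_unitary_coords:
  "unitary U \<Longrightarrow> (\<Sum>i\<in>UNIV. (cmod ((adjoint_mat U *v x) $ i))\<^sup>2) = inner x x"
  using inner_udiag[of x U "\<lambda>_. 1"] by (simp add: udiag_one)

lemma pos_def_udiag_iff:
  assumes U: "unitary U"
  shows "pos_def (udiag U d) \<longleftrightarrow> (\<forall>i. 0 < d i)"
proof
  assume P: "pos_def (udiag U d)"
  show "\<forall>i. 0 < d i"
  proof
    fix i
    \<comment> \<open>The test vector is the \<open>i\<close>-th column of \<open>U\<close>, where
      the quadratic form takes the value \<open>d i\<close>.\<close>
    have "adjoint_mat U *v (U *v axis i 1) = axis i 1"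
      using U by (simp add: unitaryD)
    moreover from this have "U *v axis i 1 \<noteq> 0"
      by (metis matrix_vector_mult_0_right axis_eq_0_iff zero_neq_one)
    ultimately have "0 < (\<Sum>j\<in>UNIV. d j * (cmod (axis i 1 $ j))\<^sup>2)"
      using P by (metis inner_udiag pos_def_iff_inner)
    also have "\<dots> = d i"
      by (simp add: axis_def if_distrib if_distribR cong: if_cong)
    finally show "0 < d i" .
  qed
next
  assume d: "\<forall>i. 0 < d i"
  have "0 < inner x (udiag U d *v x)" if x: "x \<noteq> 0" for x
  proof -
    have "adjoint_mat U *v x \<noteq> 0"
      using U x by (metis matrix_vector_mult_0_right unitaryD(8))
    then obtain j where j: "(adjoint_mat U *v x) $ j \<noteq> 0"
      by (auto simp: vec_eq_iff)
    show ?thesis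
      unfolding inner_udiag using d j
      by (intro sum_pos2[of _ j]) (auto simp: less_imp_le)
  qed
  then show "pos_def (udiag U d)"
    by (simp add: pos_def_iff_inner hermitian_udiag)
qed

section \<open>The spectral theorem\<close>

text \<open>The conjugated vectors are put into the rows of a square matrix with zero rows outside
  \<open>T\<close>. Row \<open>j\<close> makes it singular, and any nonzero kernel vector is
  orthogonal to all \<open>u i\<close> with \<open>i\<close> in \<open>T\<close>.\<close>

lemma exists_orthogonal:
  fixes u :: "'n::finite \<Rightarrow> complex^'n"
  assumes "j \<notin> T"
  shows "\<exists>x. x \<noteq> 0 \<and> (\<forall>i\<in>T. (\<Sum>k\<in>UNIV. cnj (u i $ k) * x $ k) = 0)"
proof -
  define R :: "complex^'n^'n" where "R = (\<chi> i k. if i \<in> T then cnj (u i $ k) else 0)"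
  have "row j R = 0"
    using assms by (simp add: row_def R_def vec_eq_iff)
  then have "det R = 0" by (rule det_zero_row)
  then have "\<nexists>B. B ** R = mat 1"
    by (metis det_I det_mul mult_zero_right zero_neq_one)
  then obtain x where x: "x \<noteq> 0" "R *v x = 0"
    using matrix_left_invertible_ker by blast
  have "(\<Sum>k\<in>UNIV. cnj (u i $ k) * x $ k) = 0" if "i \<in> T" for i
  proof -
    have "(R *v x) $ i = 0" using x by simp
    then show ?thesis using that by (simp add: R_def matrix_vector_mult_def)
  qed
  with x show ?thesis by blast
qed

lemma hermitian_inner: "hermitian A \<Longrightarrow> inner x (A *v y) = inner (A *v x) y"
  by (metis hermitian_def inner_mult_adjoint)

text \<open>A maximiser \<open>x\<close> of the quadratic form on the unit sphere of
  \<open>S\<close> is an eigenvector: otherwise the residual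
  \<open>z = A *v x - l *\<^sub>R x\<close>, which lies in \<open>S\<close> by invariance, would be
  a direction in which the Rayleigh quotient increases.\<close>

lemma hermitian_eigenvector:
  fixes A :: "complex^'n^'n"
  assumes A: "hermitian A" and S: "subspace S" and inv: "\<And>x. x \<in> S \<Longrightarrow> A *v x \<in> S"
    and ne: "x0 \<in> S" "x0 \<noteq> 0"
  obtains x l where "x \<in> S" "inner x x = 1" "A *v x = l *\<^sub>R x"
proof -
  let ?K = "S \<inter> sphere 0 1"
  have "compact ?K"
    using S by (intro closed_Int_compact closed_subspace) auto
  moreover have "x0 /\<^sub>R norm x0 \<in> ?K"
    using ne S by (auto simp: subspace_mul)
  then have "?K \<noteq> {}" by blast
  moreover have "continuous_on ?K (\<lambda>x. inner x (A *v x))"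
    by (intro continuous_intros matrix_vector_mul_bounded_linear[THEN linear_continuous_on])
  ultimately obtain x where x: "x \<in> ?K" and mx: "\<And>y. y \<in> ?K \<Longrightarrow> inner y (A *v y) \<le> inner x (A *v x)"
    using continuous_attains_sup[of ?K "\<lambda>x. inner x (A *v x)"] by blast
  define l where "l = inner x (A *v x)"
  have xx: "inner x x = 1" and xS: "x \<in> S"
    using x by (auto simp: dot_square_norm)
  have bound: "inner y (A *v y) \<le> l * inner y y" if y: "y \<in> S" for y
  proof (cases "y = 0")
    case False
    have "y /\<^sub>R norm y \<in> ?K"
      using False y S by (auto simp: subspace_mul)
    from mx[OF this] have "inner y (A *v y) / (norm y * norm y) \<le> l"
      by (simp add: l_def mult_vec_scaleR divide_inverse mult_ac)
    then have "inner y (A *v y) \<le> l * (norm y * norm y)"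
      using False by (simp add: pos_divide_le_eq)
    then show ?thesis by (simp add: dot_square_norm power2_eq_square)
  qed simp
  define z where "z = A *v x - l *\<^sub>R x"
  have zS: "z \<in> S"
    unfolding z_def using S xS inv by (intro subspace_diff subspace_mul) auto
  define q where "q = inner z (A *v z) - l * inner z z"
  \<comment> \<open>Maximality is tested at \<open>x + e *\<^sub>R z\<close>. The terms with
    \<open>inner z x\<close> cancel, leaving a linear term in \<open>e\<close> with positive slope
    unless \<open>z = 0\<close>.\<close>
  have quad: "2 * e * inner z z + e\<^sup>2 * q \<le> 0" for e
  proof -
    let ?y = "x + e *\<^sub>R z"
    have Axz: "A *v x = z + l *\<^sub>R x" by (simp add: z_def)
    have "?y \<in> S" using S xS zS by (intro subspace_add subspace_mul) auto
    from bound[OF this] have "inner ?y (A *v ?y) - l * inner ?y ?y \<le> 0" by simp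
    also have "inner ?y (A *v ?y) = l + e * inner x (A *v z) + e * inner z (A *v x) + e\<^sup>2 * inner z (A *v z)"
      by (simp add: matrix_vector_right_distrib mult_vec_scaleR inner_add_left inner_add_right
          power2_eq_square ring_distribs l_def)
    also have "inner x (A *v z) = inner z (A *v x)"
      using hermitian_inner[OF A, of x z] by (simp add: inner_commute)
    also have "inner z (A *v x) = inner z z + l * inner z x"
      by (simp add: Axz inner_add_right)
    also have "l * inner ?y ?y = l + 2 * e * l * inner z x + e\<^sup>2 * (l * inner z z)"
      using xx by (simp add: inner_add_left inner_add_right power2_eq_square ring_distribs inner_commute)
    finally show ?thesis
      by (simp add: q_def ring_distribs)
  qed
  have "z = 0"
  proof (rule ccontr)
    assume "z \<noteq> 0"
    then have pos: "inner z z > 0" by simp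
    \<comment> \<open>This \<open>e\<close> is so small that the quadratic term can absorb at most
      half of the linear one.\<close>
    define e where "e = inner z z / (1 + \<bar>q\<bar>)"
    have e: "e > 0" using pos by (simp add: e_def)
    have "e * \<bar>q\<bar> \<le> inner z z"
      using pos by (simp add: e_def field_simps)
    then have "e * (e * \<bar>q\<bar>) \<le> e * inner z z"
      using e by (intro mult_left_mono) auto
    moreover have "e\<^sup>2 * q \<ge> - (e * (e * \<bar>q\<bar>))"
    proof -
      have "e * e * (-q) \<le> e * e * \<bar>q\<bar>" by (intro mult_left_mono) auto
      then show ?thesis by (simp add: power2_eq_square)
    qed
    moreover have "e * inner z z > 0" using e pos by simp
    ultimately show False using quad[of e] by simp
  qed
  then have "A *v x = l *\<^sub>R x" by (simp add: z_def)
  with that xS xx show ?thesis by blast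
qed

text \<open>Induction on the index set: the orthogonal complement of the eigenvectors found so far
  is invariant under \<open>A\<close> and nonzero because index \<open>j\<close> is still free, so
  it contains a further eigenvector. Taking \<open>T\<close> inside the index type does the
  dimension count.\<close>

lemma hermitian_eigenbasis:
  fixes A :: "complex^'n^'n"
  assumes A: "hermitian A" and T: "finite T"
  shows "\<exists>u l. \<forall>i\<in>(T :: 'n set). A *v u i = (l i :: real) *\<^sub>R u i \<and>
           (\<forall>j\<in>T. (\<Sum>k\<in>UNIV. cnj (u i $ k) * u j $ k) = (if i = j then 1 else 0))"
  using T
proof (induction T)
  case (insert j T)
  then obtain u :: "'n \<Rightarrow> complex^'n" and l :: "'n \<Rightarrow> real"
    where u: "\<And>i. i \<in> T \<Longrightarrow> A *v u i = l i *\<^sub>R u i"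
      "\<And>i i'. i \<in> T \<Longrightarrow> i' \<in> T \<Longrightarrow>
         (\<Sum>k\<in>UNIV. cnj (u i $ k) * u i' $ k) = (if i = i' then 1 else 0)"
    by blast
  \<comment> \<open>Orthogonality is meant for the complex form, as unitarity requires; its real
    part \<open>inner\<close> would be too weak.\<close>
  define S where "S = {x. \<forall>i\<in>T. (\<Sum>k\<in>UNIV. cnj (u i $ k) * x $ k) = 0}"
  have S: "subspace S"
    unfolding subspace_def S_def
    by (auto simp: sum.distrib distrib_left scaleR_conv_of_real[where 'a=complex] mult.left_commute
        simp flip: sum_distrib_left)
  obtain x0 where x0: "x0 \<in> S" "x0 \<noteq> 0"
    using exists_orthogonal[OF insert.hyps(2), of u] unfolding S_def by blast
  have inv: "A *v x \<in> S" if x: "x \<in> S" for x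
    unfolding S_def
  proof (clarify)
    fix i assume i: "i \<in> T"
    have herm: "cnj (A $ k $ m) = A $ m $ k" for k m
      using adjoint_nth[of A m k] A by (simp add: hermitian_def del: adjoint_nth)
    have "(\<Sum>k\<in>UNIV. cnj (u i $ k) * (A *v x) $ k) =
          (\<Sum>k\<in>UNIV. \<Sum>m\<in>UNIV. cnj (u i $ k) * A $ k $ m * x $ m)"
      by (simp add: matrix_vector_mult_def sum_distrib_left mult_ac)
    also have "\<dots> = (\<Sum>m\<in>UNIV. \<Sum>k\<in>UNIV. cnj (u i $ k) * A $ k $ m * x $ m)"
      by (rule sum.swap)
    also have "\<dots> = (\<Sum>m\<in>UNIV. cnj ((A *v u i) $ m) * x $ m)"
      by (simp add: matrix_vector_mult_def sum_distrib_left sum_distrib_right herm mult_ac)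
    also have "\<dots> = of_real (l i) * (\<Sum>m\<in>UNIV. cnj (u i $ m) * x $ m)"
      using u(1)[OF i] by (simp add: sum_distrib_left scaleR_conv_of_real[where 'a=complex] mult_ac)
    also have "\<dots> = 0" using x i by (simp add: S_def)
    finally show "(\<Sum>k\<in>UNIV. cnj (u i $ k) * (A *v x) $ k) = 0" .
  qed
  obtain x m where x: "x \<in> S" "inner x x = 1" "A *v x = m *\<^sub>R x"
    using hermitian_eigenvector[OF A S inv x0] by blast
  have xx: "(\<Sum>k\<in>UNIV. cnj (x $ k) * x $ k) = 1"
    using x(2) by (simp add: inner_vec_def inner_complex_eq complex_eq_iff)
  have ux: "(\<Sum>k\<in>UNIV. cnj (u i $ k) * x $ k) = 0" if "i \<in> T" for i
    using x(1) that by (simp add: S_def)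
  have xu: "(\<Sum>k\<in>UNIV. cnj (x $ k) * u i $ k) = 0" if "i \<in> T" for i
    using arg_cong[OF ux[OF that], of cnj] by (simp add: mult.commute)
  have jT: "i \<noteq> j" "j \<noteq> i" if "i \<in> T" for i using insert.hyps that by auto
  show ?case
    by (rule exI[of _ "u(j := x)"], rule exI[of _ "l(j := m)"])
      (auto simp: u x xx ux xu jT)
qed simp

theorem hermitian_eq_udiag:
  fixes A :: "complex^'n^'n"
  assumes "hermitian A"
  obtains U d where "unitary U" "A = udiag U d"
proof -
  obtain u :: "'n \<Rightarrow> complex^'n" and l where u: "\<And>i. A *v u i = (l i :: real) *\<^sub>R u i"
    "\<And>i j. (\<Sum>k\<in>UNIV. cnj (u i $ k) * u j $ k) = (if i = j then 1 else 0)"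
    using hermitian_eigenbasis[OF assms, of UNIV] by auto
  define U :: "complex^'n^'n" where "U = (\<chi> i j. u j $ i)"
  have U: "unitary U"
    by (intro unitaryI) (simp add: U_def vec_eq_iff matrix_matrix_mult_def mat_def u)
  have "A ** U = U ** diag_mat l"
  proof (simp add: vec_eq_iff, intro allI)
    fix i j
    have "(A *v u j) $ i = of_real (l j) * u j $ i"
      by (simp add: u scaleR_conv_of_real[where 'a=complex])
    then show "(A ** U) $ i $ j = U $ i $ j * of_real (l j)"
      by (simp add: U_def matrix_matrix_mult_def matrix_vector_mult_def mult.commute)
  qed
  then have "A ** U ** adjoint_mat U = udiag U l" by (simp add: udiag_def)
  with U that show ?thesis by (simp add: unitaryD)
qed

lemma pos_def_eq_udiag:
  assumes "pos_def A"
  obtains U d where "unitary U" "A = udiag U d" "\<And>i. 0 < d i"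
proof -
  have "hermitian A" using assms by (simp add: pos_def_def)
  then obtain U d where *: "unitary U" "A = udiag U d" by (rule hermitian_eq_udiag)
  then have "0 < d i" for i using assms pos_def_udiag_iff by blast
  with * that show ?thesis by blast
qed

section \<open>Operator concavity of the logarithm\<close>

text \<open>Each difference \<open>ln (d i + s) - ln s\<close> equals
  \<open>ln (1 + d i / s)\<close> and vanishes at infinity. This supplies the boundary value at
  infinity when resolvents are integrated to logarithms.\<close>

lemma sum_ln_shift_tendsto:
  fixes a d :: "'i::finite \<Rightarrow> real"
  assumes "\<And>i. 0 < d i"
  shows "((\<lambda>s. (\<Sum>i\<in>UNIV. a i * ln (d i + s)) - (\<Sum>i\<in>UNIV. a i) * ln s) \<longlongrightarrow> 0) at_top"
proof -
  have "((\<lambda>s. ln (d i + s) - ln s) \<longlongrightarrow> 0) at_top" for i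
  proof (rule Lim_transform_eventually)
    have "((\<lambda>s. d i / s) \<longlongrightarrow> 0) at_top"
      by (rule real_tendsto_divide_at_top[OF tendsto_const filterlim_ident])
    then have "((\<lambda>s. ln (1 + d i / s)) \<longlongrightarrow> ln (1 + 0)) at_top"
      by (intro tendsto_ln tendsto_add tendsto_const) auto
    then show "((\<lambda>s. ln (1 + d i / s)) \<longlongrightarrow> 0) at_top" by simp
    have eq: "ln (1 + d i / s) = ln (d i + s) - ln s" if "0 < s" for s
    proof -
      have "1 + d i / s = (d i + s) / s" using that by (simp add: field_simps)
      then show ?thesis using that assms[of i] by (simp add: ln_div add_pos_pos)
    qed
    show "eventually (\<lambda>s. ln (1 + d i / s) = ln (d i + s) - ln s) at_top"
      by (rule eventually_mono[OF eventually_gt_at_top[of 0]]) (rule eq)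
  qed
  then have "((\<lambda>s. \<Sum>i\<in>UNIV. a i * (ln (d i + s) - ln s)) \<longlongrightarrow> (\<Sum>i\<in>UNIV. a i * 0)) at_top"
    by (intro tendsto_intros)
  then show ?thesis
    by (simp add: right_diff_distrib sum_subtractf sum_distrib_right)
qed

text \<open>Integration over \<open>s\<close> without integrals: the difference \<open>F\<close> of
  the two sides, with all arguments shifted by \<open>s\<close>, has the difference of the resolvent
  sums as derivative. So \<open>F\<close> is nonincreasing, and since it tends to 0 at infinity,
  \<open>F 0\<close> is nonnegative.\<close>

lemma sum_ln_le_of_resolvents:
  fixes a b c x y z :: "'i::finite \<Rightarrow> real"
  assumes pos: "\<And>i. 0 < x i" "\<And>i. 0 < y i" "\<And>i. 0 < z i"
    and sums: "(\<Sum>i\<in>UNIV. b i) = (\<Sum>i\<in>UNIV. a i)" "(\<Sum>i\<in>UNIV. c i) = (\<Sum>i\<in>UNIV. a i)"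
    and res: "\<And>s. 0 \<le> s \<Longrightarrow> (\<Sum>i\<in>UNIV. a i * (1 / (x i + s))) \<le>
       (1 - t) * (\<Sum>i\<in>UNIV. b i * (1 / (y i + s))) + t * (\<Sum>i\<in>UNIV. c i * (1 / (z i + s)))"
  shows "(1 - t) * (\<Sum>i\<in>UNIV. b i * ln (y i)) + t * (\<Sum>i\<in>UNIV. c i * ln (z i)) \<le>
    (\<Sum>i\<in>UNIV. a i * ln (x i))"
proof -
  define F where "F s = (\<Sum>i\<in>UNIV. a i * ln (x i + s)) -
    ((1 - t) * (\<Sum>i\<in>UNIV. b i * ln (y i + s)) + t * (\<Sum>i\<in>UNIV. c i * ln (z i + s)))" for s
  have deriv: "\<exists>D. (F has_real_derivative D) (at s) \<and> D \<le> 0" if "0 \<le> s" for s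
  proof -
    have p: "0 < x i + s" "0 < y i + s" "0 < z i + s" for i
      using pos that by (simp_all add: add_pos_nonneg)
    have "(F has_real_derivative (\<Sum>i\<in>UNIV. a i * (1 / (x i + s))) -
       ((1 - t) * (\<Sum>i\<in>UNIV. b i * (1 / (y i + s))) + t * (\<Sum>i\<in>UNIV. c i * (1 / (z i + s))))) (at s)"
      unfolding F_def by (rule derivative_eq_intros refl p | simp)+
    with res[OF that] show ?thesis by force
  qed
  have "F s \<le> F 0" if "0 \<le> s" for s
    by (rule DERIV_nonpos_imp_nonincreasing[OF that deriv])
  then have "eventually (\<lambda>s. F s \<le> F 0) at_top"
    using eventually_ge_at_top[of 0] by (rule eventually_mono[rotated])
  moreover have "(F \<longlongrightarrow> 0 - ((1 - t) * 0 + t * 0)) at_top"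
  proof (rule Lim_transform_eventually)
    \<comment> \<open>The divergent \<open>ln s\<close> terms cancel because the three families of
      weights have the same total.\<close>
    let ?L = "\<lambda>a d s. (\<Sum>i\<in>UNIV. a i * ln (d i + s)) - (\<Sum>i\<in>UNIV. a i) * ln s"
    show "((\<lambda>s. ?L a x s - ((1 - t) * ?L b y s + t * ?L c z s)) \<longlongrightarrow> 0 - ((1 - t) * 0 + t * 0)) at_top"
      using pos by (intro tendsto_intros sum_ln_shift_tendsto)
    show "eventually (\<lambda>s. ?L a x s - ((1 - t) * ?L b y s + t * ?L c z s) = F s) at_top"
      by (simp add: F_def sums algebra_simps)
  qed
  ultimately have "0 \<le> F 0"
    using tendsto_upperbound[of F 0 at_top "F 0"] by simp
  then show ?thesis by (simp add: F_def)
qed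

section \<open>Variational description of resolvents\<close>

lemma inner_adjoint_unitary:
  "unitary U \<Longrightarrow> inner (adjoint_mat U *v u) (adjoint_mat U *v v) = inner u v"
  by (simp add: inner_mult_adjoint unitaryD)

text \<open>Completing the square in each eigencoordinate: with \<open>k = d i + s\<close>, the
  square of \<open>k * cmod a - cmod b\<close>, divided by \<open>k\<close>, is nonnegative.\<close>

lemma resolvent_upper:
  fixes u v :: "complex^'n"
  assumes U: "unitary U" and d: "\<And>i. 0 < d i + s"
  shows "2 * inner u v - inner u (udiag U d *v u) - s * inner u u
    \<le> inner v (udiag U (\<lambda>i. 1 / (d i + s)) *v v)"
proof -
  have scalar: "2 * inner a b - k * (cmod a)\<^sup>2 \<le> 1 / k * (cmod b)\<^sup>2" if k: "0 < k" for k and a b :: complex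
  proof -
    have "inner a b \<le> cmod a * cmod b" by (rule norm_cauchy_schwarz)
    moreover have "0 \<le> (k * cmod a - cmod b)\<^sup>2 / k" using k by simp
    then have "0 \<le> k * (cmod a)\<^sup>2 - 2 * (cmod a * cmod b) + 1 / k * (cmod b)\<^sup>2"
      using k by (simp add: power2_diff power_mult_distrib field_simps power2_eq_square)
    ultimately show ?thesis by linarith
  qed
  let ?u = "adjoint_mat U *v u" and ?v = "adjoint_mat U *v v"
  have "2 * inner u v - inner u (udiag U d *v u) - s * inner u u =
    (\<Sum>i\<in>UNIV. 2 * inner (?u $ i) (?v $ i) - (d i + s) * (cmod (?u $ i))\<^sup>2)"
    unfolding inner_udiag sum_unitary_coords[OF U, of u, symmetric] inner_adjoint_unitary[OF U, of u v, symmetric]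
    by (simp add: inner_vec_def[of ?u ?v] sum_distrib_left sum_subtractf sum.distrib distrib_right)
  also have "\<dots> \<le> (\<Sum>i\<in>UNIV. 1 / (d i + s) * (cmod (?v $ i))\<^sup>2)"
    by (intro sum_mono scalar d)
  finally show ?thesis by (simp only: inner_udiag)
qed

text \<open>Equality occurs at the resolvent applied to \<open>v\<close>, since this
  \<open>u\<close> solves \<open>udiag U d *v u + s *\<^sub>R u = v\<close>.\<close>

lemma resolvent_attained:
  assumes U: "unitary U" and d: "\<And>i. 0 < d i + s"
  shows "\<exists>u. inner v (udiag U (\<lambda>i. 1 / (d i + s)) *v v) =
    2 * inner u v - inner u (udiag U d *v u) - s * inner u u"
proof
  let ?u = "udiag U (\<lambda>i. 1 / (d i + s)) *v v"
  have "udiag U d *v ?u + s *\<^sub>R ?u = (udiag U d + s *\<^sub>R udiag U (\<lambda>_. 1)) *v ?u"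
    by (simp add: matrix_vector_mult_add_rdistrib scaleR_mult_vec udiag_one U)
  also have "\<dots> = udiag U (\<lambda>i. (d i + s) * (1 / (d i + s))) *v v"
    by (simp add: udiag_scaleR udiag_add matrix_vector_mul_assoc udiag_mult U)
  also have "\<dots> = v"
    using d by (simp add: less_imp_neq[THEN not_sym] udiag_one U)
  finally have "inner ?u (udiag U d *v ?u + s *\<^sub>R ?u) = inner ?u v" by simp
  then show "inner v ?u = 2 * inner ?u v - inner ?u (udiag U d *v ?u) - s * inner ?u ?u"
    by (simp add: inner_add_right inner_commute)
qed

text \<open>The right-hand sides are lower bounds for the quadratic forms of the resolvents
  \<open>(X\<^sub>i + s)\<^sup>-\<^sup>1\<close> at \<open>v\<close>, and the left-hand side has supremum \<open>v \<bullet> (Y + s)\<^sup>-\<^sup>1 v\<close>;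
  the logarithm is minus an integral of resolvents.\<close>

lemma mat_ln_form_ge:
  fixes v :: "complex^'n"
  assumes Y: "pos_def Y" and X1: "pos_def X1" and X2: "pos_def X2" and t: "0 \<le> t" "t \<le> 1"
    and ex: "\<And>s u. 0 \<le> s \<Longrightarrow> \<exists>u1 u2. 2 * inner u v - inner u (Y *v u) - s * inner u u \<le>
      (1 - t) * (2 * inner u1 v - inner u1 (X1 *v u1) - s * inner u1 u1) +
      t * (2 * inner u2 v - inner u2 (X2 *v u2) - s * inner u2 u2)"
  shows "(1 - t) * inner v (mat_ln X1 *v v) + t * inner v (mat_ln X2 *v v) \<le> inner v (mat_ln Y *v v)"
proof -
  obtain U x where U: "unitary U" "Y = udiag U x" "\<And>i. 0 < x i" using pos_def_eq_udiag[OF Y] by blast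
  obtain V y where V: "unitary V" "X1 = udiag V y" "\<And>i. 0 < y i" using pos_def_eq_udiag[OF X1] by blast
  obtain W z where W: "unitary W" "X2 = udiag W z" "\<And>i. 0 < z i" using pos_def_eq_udiag[OF X2] by blast
  let ?a = "\<lambda>U i. (cmod ((adjoint_mat U *v v) $ i))\<^sup>2"
  have form: "inner v (udiag U f *v v) = (\<Sum>i\<in>UNIV. ?a U i * f i)" for U f
    by (simp add: inner_udiag mult.commute)
  have "(1 - t) * (\<Sum>i\<in>UNIV. ?a V i * ln (y i)) + t * (\<Sum>i\<in>UNIV. ?a W i * ln (z i)) \<le>
    (\<Sum>i\<in>UNIV. ?a U i * ln (x i))"
  proof (rule sum_ln_le_of_resolvents[OF U(3) V(3) W(3)])
    fix s :: real assume s: "0 \<le> s"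
    have p: "0 < x i + s" "0 < y i + s" "0 < z i + s" for i
      using s U(3) V(3) W(3) by (simp_all add: add_pos_nonneg)
    obtain u where u: "inner v (udiag U (\<lambda>i. 1 / (x i + s)) *v v) =
        2 * inner u v - inner u (Y *v u) - s * inner u u"
      using resolvent_attained[where d = x and s = s and v = v, OF U(1) p(1)] U(2) by blast
    obtain u1 u2 where "2 * inner u v - inner u (Y *v u) - s * inner u u \<le>
      (1 - t) * (2 * inner u1 v - inner u1 (X1 *v u1) - s * inner u1 u1) +
      t * (2 * inner u2 v - inner u2 (X2 *v u2) - s * inner u2 u2)"
      using ex[OF s] by blast
    also have "\<dots> \<le> (1 - t) * inner v (udiag V (\<lambda>i. 1 / (y i + s)) *v v) +
        t * inner v (udiag W (\<lambda>i. 1 / (z i + s)) *v v)"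
      unfolding V(2) W(2) using t
      by (intro add_mono mult_left_mono resolvent_upper V W p) auto
    finally show "(\<Sum>i\<in>UNIV. ?a U i * (1 / (x i + s))) \<le>
       (1 - t) * (\<Sum>i\<in>UNIV. ?a V i * (1 / (y i + s))) + t * (\<Sum>i\<in>UNIV. ?a W i * (1 / (z i + s)))"
      unfolding u[symmetric] form .
  qed (simp_all add: sum_unitary_coords U V W)
  then show ?thesis
    unfolding mat_ln_def U(2) V(2) W(2) by (simp add: matfun_udiag U(1) V(1) W(1) form)
qed

lemma pos_def_convex:
  assumes "pos_def X1" "pos_def X2" "0 \<le> t" "t \<le> 1"
  shows "pos_def ((1 - t) *\<^sub>R X1 + t *\<^sub>R X2)"
proof -
  have "0 < (1 - t) * inner x (X1 *v x) + t * inner x (X2 *v x)" if "x \<noteq> 0" for x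
    using assms that unfolding pos_def_iff_inner
    by (cases "t = 0") (auto intro: add_nonneg_pos simp: less_imp_le)
  then show ?thesis
    using assms by (simp add: pos_def_iff_inner hermitian_def adjoint_add adjoint_scaleR
        matrix_vector_mult_add_rdistrib scaleR_mult_vec inner_add_right)
qed

text \<open>For fixed \<open>u\<close> the variational expression is affine in the matrix, so the
  same \<open>u\<close> serves in both lower bounds.\<close>

lemma mat_ln_concave:
  assumes "pos_def X1" "pos_def X2" "0 \<le> t" "t \<le> 1"
  shows "(1 - t) * inner v (mat_ln X1 *v v) + t * inner v (mat_ln X2 *v v)
    \<le> inner v (mat_ln ((1 - t) *\<^sub>R X1 + t *\<^sub>R X2) *v v)"
proof (rule mat_ln_form_ge[OF pos_def_convex])
  fix s u
  show "\<exists>u1 u2. 2 * inner u v - inner u (((1 - t) *\<^sub>R X1 + t *\<^sub>R X2) *v u) - s * inner u u \<le>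
      (1 - t) * (2 * inner u1 v - inner u1 (X1 *v u1) - s * inner u1 u1) +
      t * (2 * inner u2 v - inner u2 (X2 *v u2) - s * inner u2 u2)"
    by (rule exI[of _ u], rule exI[of _ u])
      (simp add: matrix_vector_mult_add_rdistrib scaleR_mult_vec inner_add_right, simp add: algebra_simps)
qed (use assms in auto)

section \<open>Congruences and Jensen's inequality for contractions\<close>

lemma pos_def_congruence:
  assumes X: "pos_def X" and Z: "Z' ** Z = mat 1"
  shows "pos_def (adjoint_mat Z ** X ** Z)"
proof -
  have "0 < inner x ((adjoint_mat Z ** X ** Z) *v x)" if x: "x \<noteq> 0" for x
  proof -
    have "Z' *v (Z *v x) = x" by (simp add: matrix_vector_mul_assoc Z)
    then have "Z *v x \<noteq> 0" using x by (metis matrix_vector_mult_0_right)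
    moreover have "inner x ((adjoint_mat Z ** X ** Z) *v x) = inner (Z *v x) (X *v (Z *v x))"
      by (simp add: inner_mult_adjoint flip: matrix_vector_mul_assoc)
    ultimately show ?thesis using X by (simp add: pos_def_iff_inner)
  qed
  then show ?thesis
    using X by (simp add: pos_def_iff_inner hermitian_def adjoint_mult matrix_mul_assoc)
qed

lemma pos_def_diag_congruence:
  fixes X :: "complex^'n^'n"
  assumes "pos_def X" "\<And>i. 0 < c i"
  shows "pos_def (diag_mat c ** X ** diag_mat c)"
proof -
  have "diag_mat (\<lambda>i. 1 / c i) ** diag_mat c = (mat 1 :: complex^'n^'n)"
    using assms(2) by (simp add: diag_mat_mult less_imp_neq[THEN not_sym] diag_mat_one)
  from pos_def_congruence[OF assms(1) this] show ?thesis by simp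
qed

text \<open>The test vector \<open>?C *v u\<close> for \<open>X\<close> does at least as well as
  \<open>u\<close> for the congruence: the pairing with \<open>v\<close> is unchanged because
  \<open>v\<close> is fixed by the contraction, the \<open>X\<close>-terms agree, and the squared
  norm does not grow.\<close>

lemma mat_ln_contract:
  fixes X :: "complex^'n^'n"
  assumes X: "pos_def X" and c: "\<And>i. 0 < c i" "\<And>i. c i \<le> 1" and v: "diag_mat c *v v = v"
  shows "inner v (mat_ln X *v v) \<le> inner v (mat_ln (diag_mat c ** X ** diag_mat c) *v v)"
proof -
  let ?C = "diag_mat c :: complex^'n^'n"
  \<comment> \<open>The weight \<open>t = 0\<close> reduces \<open>mat_ln_form_ge\<close> to a
    comparison of two matrices.\<close>
  have "(1 - 0) * inner v (mat_ln X *v v) + 0 * inner v (mat_ln X *v v)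
      \<le> inner v (mat_ln (?C ** X ** ?C) *v v)"
  proof (rule mat_ln_form_ge)
    fix s :: real and u assume s: "0 \<le> s"
    have "inner u v = inner (?C *v u) v"
      using inner_mult_adjoint[of u ?C v] v by simp
    moreover have "inner u ((?C ** X ** ?C) *v u) = inner (?C *v u) (X *v (?C *v u))"
      by (simp add: inner_mult_adjoint flip: matrix_vector_mul_assoc)
    moreover have "inner (?C *v u) (?C *v u) \<le> inner u u"
      unfolding inner_vec_def
    proof (intro sum_mono)
      fix i
      have "(c i)\<^sup>2 \<le> 1" using c by (simp add: power_le_one less_imp_le)
      then have "(c i)\<^sup>2 * inner (u $ i) (u $ i) \<le> 1 * inner (u $ i) (u $ i)"
        by (intro mult_right_mono) auto
      then show "inner ((?C *v u) $ i) ((?C *v u) $ i) \<le> inner (u $ i) (u $ i)"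
        by (simp add: norm_mult power_mult_distrib flip: power2_norm_eq_inner)
    qed
    ultimately have "2 * inner u v - inner u ((?C ** X ** ?C) *v u) - s * inner u u \<le>
       (1 - 0) * (2 * inner (?C *v u) v - inner (?C *v u) (X *v (?C *v u)) - s * inner (?C *v u) (?C *v u)) +
       0 * (2 * inner u v - inner u (X *v u) - s * inner u u)"
      using s by (simp add: mult_left_mono)
    then show "\<exists>u1 u2. 2 * inner u v - inner u ((?C ** X ** ?C) *v u) - s * inner u u \<le>
       (1 - 0) * (2 * inner u1 v - inner u1 (X *v u1) - s * inner u1 u1) +
       0 * (2 * inner u2 v - inner u2 (X *v u2) - s * inner u2 u2)"
      by blast
  qed (use X c in \<open>auto intro: pos_def_diag_congruence\<close>)
  then show ?thesis by simp
qed

lemma inner_axis_mult: "inner (axis i 1) (M *v axis i 1) = Re (M $ i $ i)"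
  for M :: "complex^'n^'n"
  by (simp add: inner_axis' inner_complex_def)
    (simp add: matrix_vector_mult_def axis_def if_distrib cong: if_cong)

lemma mat_ln_contract_nth:
  assumes "pos_def X" "\<And>j. 0 < c j" "\<And>j. c j \<le> 1" "c i = 1"
  shows "Re (mat_ln X $ i $ i) \<le> Re (mat_ln (diag_mat c ** X ** diag_mat c) $ i $ i)"
proof -
  have "diag_mat c *v axis i 1 = axis i 1"
    using assms(4) by (simp add: vec_eq_iff axis_def)
  from mat_ln_contract[OF assms(1-3) this] show ?thesis by (simp add: inner_axis_mult)
qed

section \<open>Traces of logarithms under diagonal congruence\<close>

lemma det_udiag:
  fixes U :: "complex^'n^'n"
  assumes "unitary U"
  shows "det (udiag U d) = of_real (\<Prod>i\<in>UNIV. d i)"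
proof -
  have "det (udiag U d) = det (adjoint_mat U ** U) * det (diag_mat d :: complex^'n^'n)"
    by (simp add: udiag_def det_mul)
  also have "\<dots> = det (diag_mat d :: complex^'n^'n)"
    using assms by (simp add: unitaryD)
  also have "\<dots> = of_real (\<Prod>i\<in>UNIV. d i)"
    by (subst det_diagonal) (simp_all add: diag_mat_def)
  finally show ?thesis .
qed

lemma trace_udiag:
  assumes U: "unitary U"
  shows "(\<Sum>i\<in>UNIV. Re (udiag U d $ i $ i)) = (\<Sum>i\<in>UNIV. d i)"
proof -
  have "(\<Sum>i\<in>UNIV. Re (udiag U d $ i $ i)) = (\<Sum>l\<in>UNIV. \<Sum>i\<in>UNIV. d l * Re (cnj (U $ i $ l) * U $ i $ l))"
    unfolding udiag_nth Re_sum by (subst sum.swap) (simp add: mult_ac)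
  also have "\<dots> = (\<Sum>l\<in>UNIV. d l * Re ((adjoint_mat U ** U) $ l $ l))"
    by (simp add: matrix_matrix_mult_def sum_distrib_left)
  also have "\<dots> = (\<Sum>l\<in>UNIV. d l)"
    unfolding unitaryD[OF U] by (simp add: mat_def)
  finally show ?thesis .
qed

lemma trace_mat_ln:
  assumes "pos_def Y"
  shows "(\<Sum>i\<in>UNIV. Re (mat_ln Y $ i $ i)) = ln (Re (det Y))" "0 < Re (det Y)" "Im (det Y) = 0"
proof -
  obtain U x where U: "unitary U" "Y = udiag U x" "\<And>i. 0 < x i"
    using pos_def_eq_udiag[OF assms] by blast
  show "(\<Sum>i\<in>UNIV. Re (mat_ln Y $ i $ i)) = ln (Re (det Y))"
    using U less_imp_neq[OF U(3), THEN not_sym]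
    by (simp add: mat_ln_def matfun_udiag trace_udiag det_udiag ln_prod del: of_real_prod)
  show "0 < Re (det Y)" "Im (det Y) = 0"
    using U by (simp_all add: det_udiag prod_pos del: of_real_prod)
qed

text \<open>The logarithm itself is not additive for noncommuting factors, but its trace is the
  logarithm of the determinant, which is multiplicative.\<close>

lemma trace_mat_ln_diag_congruence:
  fixes X :: "complex^'n^'n"
  assumes X: "pos_def X" and k: "\<And>i. 0 < k i"
  shows "(\<Sum>i\<in>UNIV. Re (mat_ln (diag_mat k ** X ** diag_mat k) $ i $ i)) =
    (\<Sum>i\<in>UNIV. 2 * ln (k i)) + (\<Sum>i\<in>UNIV. Re (mat_ln X $ i $ i))"
proof -
  have dk: "det (diag_mat k :: complex^'n^'n) = of_real (\<Prod>i\<in>UNIV. k i)"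
    by (subst det_diagonal) (simp_all add: diag_mat_def)
  have p: "0 < (\<Prod>i\<in>UNIV. k i)" using k by (simp add: prod_pos)
  have "Re (det (diag_mat k ** X ** diag_mat k)) = (\<Prod>i\<in>UNIV. k i) * Re (det X) * (\<Prod>i\<in>UNIV. k i)"
    by (simp add: det_mul dk del: of_real_prod)
  moreover have "ln ((\<Prod>i\<in>UNIV. k i) * Re (det X) * (\<Prod>i\<in>UNIV. k i)) =
      ln (Re (det X)) + 2 * ln (\<Prod>i\<in>UNIV. k i)"
  proof -
    have "ln (P * q * P) = ln q + 2 * ln P" if "0 < P" "0 < q" for P q :: real
      using that by (simp add: ln_mult)
    then show ?thesis using p trace_mat_ln(2)[OF X] by blast
  qed
  moreover have "ln (\<Prod>i\<in>UNIV. k i) = (\<Sum>i\<in>UNIV. ln (k i))"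
    using k by (simp add: ln_prod less_imp_neq[THEN not_sym])
  ultimately show ?thesis
    using trace_mat_ln(1)[OF X] trace_mat_ln(1)[OF pos_def_diag_congruence[of X k, OF X k]]
    by (simp add: sum_distrib_left)
qed

lemma mat_ln_scaleR_nth:
  assumes "pos_def X" "0 < c"
  shows "Re (mat_ln (c *\<^sub>R X) $ i $ i) = ln c + Re (mat_ln X $ i $ i)"
proof -
  obtain U x where U: "unitary U" "X = udiag U x" "\<And>i. 0 < x i"
    using pos_def_eq_udiag[OF assms(1)] by blast
  have "mat_ln (c *\<^sub>R X) = udiag U (\<lambda>i. ln c + ln (x i))"
    using assms(2) U by (simp add: mat_ln_def udiag_scaleR matfun_udiag ln_mult less_imp_neq[THEN not_sym])
  also have "\<dots> = ln c *\<^sub>R mat 1 + mat_ln X"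
    using U(1) by (simp add: mat_ln_def U(2) matfun_udiag udiag_scaleR flip: udiag_add udiag_one[OF U(1)])
  finally show ?thesis by (simp add: mat_def)
qed

text \<open>With \<open>c = min g\<close> over \<open>S\<close>, write \<open>g = c k\<^sup>2 l\<^sup>2\<close> with \<open>k = 1\<close> off \<open>S\<close> and \<open>l = 1\<close> on \<open>S\<close>, so that
  \<open>l\<close> and \<open>1/k\<close> are contractions. The entries on \<open>S\<close> are compared directly for \<open>l\<close>;
  for \<open>k\<close> the entries off \<open>S\<close> are compared, and the trace of the logarithm is known.\<close>

lemma sum_mat_ln_diag_congruence_ge:
  fixes X :: "complex^'n^'n"
  assumes X: "pos_def X" and g: "\<And>i. 0 < g i" and S: "\<And>i j. i \<in> S \<Longrightarrow> j \<notin> S \<Longrightarrow> g j \<le> g i"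
  shows "(\<Sum>i\<in>S. ln (g i) + Re (mat_ln X $ i $ i)) \<le>
    (\<Sum>i\<in>S. Re (mat_ln (diag_mat (\<lambda>i. sqrt (g i)) ** X ** diag_mat (\<lambda>i. sqrt (g i))) $ i $ i))"
proof (cases "S = {}")
  case False
  define c where "c = Min (g ` S)"
  have "c \<in> g ` S" unfolding c_def using False by (intro Min_in) auto
  then have c: "0 < c" "\<And>i. i \<in> S \<Longrightarrow> c \<le> g i" "\<And>i. i \<notin> S \<Longrightarrow> g i \<le> c"
    using g S by (auto simp: c_def)
  define k where "k i = (if i \<in> S then sqrt (g i / c) else 1)" for i
  define l where "l i = (if i \<in> S then 1 else sqrt (g i / c))" for i
  have kl: "0 < k i" "1 \<le> k i" "0 < l i" "l i \<le> 1" for i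
    using c g by (auto simp: k_def l_def)
  define X1 where "X1 = diag_mat l ** X ** diag_mat l"
  define Y1 where "Y1 = diag_mat k ** X1 ** diag_mat k"
  have pX1: "pos_def X1" unfolding X1_def by (intro pos_def_diag_congruence X kl)
  have pY1: "pos_def Y1" unfolding Y1_def by (intro pos_def_diag_congruence pX1 kl)
  have X1_eq: "X1 = diag_mat (\<lambda>i. 1 / k i) ** Y1 ** diag_mat (\<lambda>i. 1 / k i)"
    using kl(1) by (simp add: Y1_def vec_eq_iff less_imp_neq[THEN not_sym])
  have Y_eq: "diag_mat (\<lambda>i. sqrt (g i)) ** X ** diag_mat (\<lambda>i. sqrt (g i)) = c *\<^sub>R Y1"
  proof -
    have "complex_of_real (sqrt (g i)) * X $ i $ j * complex_of_real (sqrt (g j)) =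
      complex_of_real c * (complex_of_real (k i) * (complex_of_real (l i) * X $ i $ j * complex_of_real (l j))
        * complex_of_real (k j))" for i j
    proof -
      have *: "sqrt (g i) = sqrt c * (k i * l i)" for i
        using c by (simp add: k_def l_def real_sqrt_divide)
      have "complex_of_real (sqrt c) * complex_of_real (sqrt c) = complex_of_real c"
        using c by (simp flip: of_real_mult)
      then show ?thesis by (simp add: * mult_ac)
    qed
    then show ?thesis
      by (simp add: vec_eq_iff X1_def Y1_def scaleR_conv_of_real[where 'a=complex])
  qed
  have on: "Re (mat_ln X $ i $ i) \<le> Re (mat_ln X1 $ i $ i)" if "i \<in> S" for i
    unfolding X1_def by (rule mat_ln_contract_nth) (use X kl that in \<open>auto simp: l_def\<close>)
  have off: "Re (mat_ln Y1 $ i $ i) \<le> Re (mat_ln X1 $ i $ i)" if "i \<notin> S" for i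
    unfolding X1_eq by (rule mat_ln_contract_nth) (use pY1 kl that in \<open>auto simp: k_def\<close>)
  have split: "(\<Sum>i\<in>UNIV. f i) = (\<Sum>i\<in>S. f i) + (\<Sum>i\<in>-S. f i)" for f :: "'n \<Rightarrow> real"
    by (metis add.commute finite subset_UNIV sum.subset_diff Compl_eq_Diff_UNIV)
  have "(\<Sum>i\<in>UNIV. Re (mat_ln Y1 $ i $ i)) = (\<Sum>i\<in>UNIV. 2 * ln (k i)) + (\<Sum>i\<in>UNIV. Re (mat_ln X1 $ i $ i))"
    unfolding Y1_def by (rule trace_mat_ln_diag_congruence[OF pX1 kl(1)])
  moreover have "(\<Sum>i\<in>-S. Re (mat_ln Y1 $ i $ i)) \<le> (\<Sum>i\<in>-S. Re (mat_ln X1 $ i $ i))"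
    by (intro sum_mono off) auto
  moreover have "(\<Sum>i\<in>S. Re (mat_ln X $ i $ i)) \<le> (\<Sum>i\<in>S. Re (mat_ln X1 $ i $ i))"
    by (intro sum_mono on)
  \<comment> \<open>The \<open>ln c\<close> subtracted here is restored by the scalar factor
    \<open>c\<close> in \<open>Y_eq\<close>.\<close>
  moreover have "(\<Sum>i\<in>UNIV. 2 * ln (k i)) = (\<Sum>i\<in>S. ln (g i) - ln c)"
  proof -
    have "(\<Sum>i\<in>-S. 2 * ln (k i)) = 0" by (simp add: k_def)
    moreover have "2 * ln (k i) = ln (g i) - ln c" if "i \<in> S" for i
      using that c g[of i] by (simp add: k_def ln_sqrt ln_div)
    ultimately show ?thesis by (simp add: split)
  qed
  moreover have "(\<Sum>i\<in>S. Re (mat_ln (c *\<^sub>R Y1) $ i $ i)) = (\<Sum>i\<in>S. ln c) + (\<Sum>i\<in>S. Re (mat_ln Y1 $ i $ i))"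
    using mat_ln_scaleR_nth[OF pY1 c(1)] by (simp add: sum.distrib)
  ultimately show ?thesis
    unfolding Y_eq by (simp add: split sum.distrib sum_subtractf)
qed simp

section \<open>Unitarily invariant norms and the exponential\<close>

text \<open>All powers are diagonal in the basis \<open>U\<close>, so every entry of the matrix
  series is a finite combination of scalar exponential series.\<close>

lemma mat_exp_udiag:
  fixes U :: "complex^'n^'n"
  assumes U: "unitary U"
  shows "mat_exp (udiag U d) = udiag U (\<lambda>i. exp (d i))"
proof -
  have pow: "(((**) (udiag U d)) ^^ k) (mat 1) = udiag U (\<lambda>i. d i ^ k)" for k
    by (induction k) (simp_all add: U udiag_one udiag_mult)
  have "(\<lambda>k. udiag U (\<lambda>i. d i ^ k /\<^sub>R fact k) $ i $ j) sums udiag U (\<lambda>i. exp (d i)) $ i $ j" for i j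
    unfolding udiag_nth by (intro sums_sum sums_mult2 sums_of_real exp_converges)
  then have "(\<lambda>k. (1 / fact k) *\<^sub>R udiag U (\<lambda>i. d i ^ k)) sums udiag U (\<lambda>i. exp (d i))"
    unfolding sums_def
    by (intro vec_tendstoI) (simp add: udiag_scaleR divide_inverse mult.commute)
  then show ?thesis
    by (simp add: mat_exp_def pow sums_iff)
qed

text \<open>Layer-cake summation: \<open>w\<close> is a positive combination of indicators of its level sets.\<close>

lemma sum_mult_nonneg_of_levels:
  fixes w x :: "'i::finite \<Rightarrow> real"
  assumes "\<And>i. 0 \<le> w i" and "\<And>c. 0 < c \<Longrightarrow> 0 \<le> (\<Sum>i | c \<le> w i. x i)"
  shows "0 \<le> (\<Sum>i\<in>UNIV. w i * x i)"
  using assms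
proof (induction "card {i. 0 < w i}" arbitrary: w rule: less_induct)
  case less
  show ?case
  proof (cases "{i. 0 < w i} = {}")
    case True
    then have "w i = 0" for i using less.prems(1)[of i] by (auto simp: not_less intro: antisym)
    then show ?thesis by simp
  next
    case False
    define c where "c = Min (w ` {i. 0 < w i})"
    have "c \<in> w ` {i. 0 < w i}" unfolding c_def using False by (intro Min_in) auto
    then obtain k where k: "0 < w k" "w k = c" by auto
    have c: "c \<le> w i" if "0 < w i" for i unfolding c_def using that by (intro Min_le) auto
    \<comment> \<open>Removing the lowest layer of height \<open>c\<close> makes the entry at
      \<open>k\<close> vanish, so the support shrinks; the level sets of \<open>w'\<close> are those
      of \<open>w\<close> shifted by \<open>c\<close>.\<close>
    define w' where "w' i = max (w i - c) 0" for i
    have "0 \<le> (\<Sum>i\<in>UNIV. w' i * x i)"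
    proof (rule less.hyps)
      have "{i. 0 < w' i} \<subseteq> {i. 0 < w i}" "k \<notin> {i. 0 < w' i}"
        using k by (auto simp: w'_def)
      then have "{i. 0 < w' i} \<subset> {i. 0 < w i}"
        using k(1) by blast
      then show "card {i. 0 < w' i} < card {i. 0 < w i}"
        by (intro psubset_card_mono) auto
      fix c' :: real assume c': "0 < c'"
      then have "{i. c' \<le> w' i} = {i. c + c' \<le> w i}"
        by (auto simp: w'_def le_max_iff_disj)
      then show "0 \<le> (\<Sum>i | c' \<le> w' i. x i)"
        using less.prems(2)[of "c + c'"] c' k by simp
    qed (simp add: w'_def)
    moreover have "w i * x i = w' i * x i + (if c \<le> w i then c * x i else 0)" for i
    proof -
      have "w i = 0 \<or> c \<le> w i" using less.prems(1)[of i] c[of i] by (auto simp: less_le)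
      then show ?thesis using k by (auto simp: w'_def max_def algebra_simps)
    qed
    then have "(\<Sum>i\<in>UNIV. w i * x i) = (\<Sum>i\<in>UNIV. w' i * x i) + c * (\<Sum>i | c \<le> w i. x i)"
      by (simp add: sum.distrib sum.If_cases sum_distrib_left)
    ultimately show ?thesis
      using less.prems(2)[of c] k by simp
  qed
qed

text \<open>One of the finitely many permutations maximises the weighted sum. A pair in the wrong
  order could be transposed to increase it strictly.\<close>

lemma exists_monotone_rearrangement:
  fixes w g :: "'i::finite \<Rightarrow> real"
  obtains \<sigma> where "bij \<sigma>" "\<And>i j. w j < w i \<Longrightarrow> g (\<sigma> j) \<le> g (\<sigma> i)"
    "(\<Sum>i\<in>UNIV. w i * g i) \<le> (\<Sum>i\<in>UNIV. w i * g (\<sigma> i))"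
proof -
  let ?P = "{\<sigma> :: 'i \<Rightarrow> 'i. bij \<sigma>}"
  let ?f = "\<lambda>\<sigma>. \<Sum>i\<in>UNIV. w i * g (\<sigma> i)"
  have id: "id \<in> ?P" by simp
  then have "Max (?f ` ?P) \<in> ?f ` ?P" by (intro Max_in) auto
  then obtain \<sigma> where \<sigma>: "bij \<sigma>" "?f \<sigma> = Max (?f ` ?P)" by auto
  have mx: "?f \<tau> \<le> ?f \<sigma>" if "bij \<tau>" for \<tau>
    unfolding \<sigma>(2) using that by (intro Max_ge) auto
  have "g (\<sigma> j) \<le> g (\<sigma> i)" if ij: "w j < w i" for i j
  proof -
    define \<tau> where "\<tau> = \<sigma> \<circ> Transposition.transpose i j"
    have neq: "i \<noteq> j" using ij by auto
    have "0 \<le> ?f \<sigma> - ?f \<tau>"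
      using mx[of \<tau>] \<sigma>(1) by (simp add: \<tau>_def bij_comp)
    also have "\<dots> = (\<Sum>k\<in>UNIV. w k * g (\<sigma> k) - w k * g (\<tau> k))"
      by (simp add: sum_subtractf)
    also have "\<dots> = (\<Sum>k\<in>{i, j}. w k * g (\<sigma> k) - w k * g (\<tau> k))"
      by (rule sum.mono_neutral_right) (auto simp: \<tau>_def)
    also have "\<dots> = (w i - w j) * (g (\<sigma> i) - g (\<sigma> j))"
      using neq by (simp add: \<tau>_def algebra_simps)
    finally show ?thesis using ij by (simp add: zero_le_mult_iff)
  qed
  moreover have "(\<Sum>i\<in>UNIV. w i * g i) \<le> ?f \<sigma>" using mx[OF bij_id] by simp
  ultimately show ?thesis using that \<sigma>(1) by simp
qed

section \<open>Signed permutations, Fan dominance and pinching\<close>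

context
  fixes N :: "complex^'n^'n \<Rightarrow> real"
  assumes N: "unitarily_invariant_norm N"
begin

lemma ui_norm_unitary: "unitary U \<Longrightarrow> unitary V \<Longrightarrow> N (U ** X ** V) = N X"
  using N by (simp add: unitarily_invariant_norm_def)

lemma ui_norm_udiag: "unitary U \<Longrightarrow> N (udiag U d) = N (diag_mat d)"
  by (simp add: udiag_def ui_norm_unitary unitary_adjoint)

lemma ui_norm_add: "N (X + Y) \<le> N X + N Y"
  using N by (simp add: unitarily_invariant_norm_def matrix_norm_def)

lemma ui_norm_scaleR: "N (c *\<^sub>R X) = \<bar>c\<bar> * N X"
proof -
  have "c *\<^sub>R X = map_matrix (\<lambda>z. of_real c * z) X"
    by (simp add: vec_eq_iff scaleR_conv_of_real[where 'a=complex])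
  then show ?thesis
    using N by (simp add: unitarily_invariant_norm_def matrix_norm_def)
qed

text \<open>Permuting the diagonal is conjugation by the permutation matrix \<open>Q\<close>, and
  changing signs is multiplication by the unitary \<open>diag_mat s\<close>.\<close>

lemma ui_norm_signed_perm:
  assumes \<sigma>: "inj \<sigma>" and s: "\<And>i. \<bar>s i\<bar> = 1"
  shows "N (diag_mat (\<lambda>i. s i * m (\<sigma> i))) = N (diag_mat m)"
proof -
  define Q :: "complex^'n^'n" where "Q = (\<chi> i j. if j = \<sigma> i then 1 else 0)"
  have "(Q ** adjoint_mat Q) $ i $ j = (\<Sum>k\<in>UNIV. if k = \<sigma> i then if \<sigma> i = \<sigma> j then 1 else 0 else 0)" for i j
    unfolding matrix_matrix_mult_def vec_lambda_beta by (intro sum.cong refl) (auto simp: Q_def)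
  then have "Q ** adjoint_mat Q = mat 1"
    using \<sigma> by (simp add: vec_eq_iff mat_def inj_eq)
  then have Q: "unitary Q"
    by (intro unitaryI) (metis matrix_left_right_inverse)
  have "s i * s i = 1" for i using s[of i] by (metis abs_mult_self_eq mult_1)
  then have "unitary (diag_mat s :: complex^'n^'n)"
    by (intro unitaryI) (simp add: diag_mat_mult diag_mat_one)
  then have "N (diag_mat s ** udiag Q m ** mat 1) = N (diag_mat m)"
    by (simp add: ui_norm_unitary unitary_one ui_norm_udiag Q del: matrix_mul_rid)
  moreover have "udiag Q m $ i $ j = (\<Sum>k\<in>UNIV. if k = \<sigma> i then if \<sigma> i = \<sigma> j then of_real (m k) else 0 else 0)" for i j
    unfolding udiag_nth by (intro sum.cong refl) (auto simp: Q_def)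
  then have "diag_mat s ** udiag Q m ** mat 1 = diag_mat (\<lambda>i. s i * m (\<sigma> i))"
    using \<sigma> by (simp add: vec_eq_iff diag_mat_def[of "\<lambda>i. s i * _ i"] inj_eq)
  ultimately show ?thesis by simp
qed

text \<open>Fan dominance for vectors: \<open>g\<close> lies in the convex hull of the signed permutations of \<open>m\<close>.
  Otherwise a functional \<open>w\<close> separates them, which contradicts the rearrangement of \<open>\<bar>w\<bar>\<close> against \<open>g\<close>.\<close>

lemma ui_norm_diag_le_of_majorized:
  assumes g: "\<And>i. 0 \<le> g i"
    and maj: "\<And>S. (\<And>i j. i \<in> S \<Longrightarrow> j \<notin> S \<Longrightarrow> g j \<le> g i) \<Longrightarrow> sum g S \<le> sum m S"
  shows "N (diag_mat g) \<le> N (diag_mat m)"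
proof -
  define f where "f s \<sigma> = (\<chi> i. (if s i then 1 else - 1) * m (\<sigma> i))" for s :: "'n \<Rightarrow> bool" and \<sigma>
  define P where "P = (\<lambda>(s, \<sigma>). f s \<sigma>) ` (UNIV \<times> {\<sigma>. bij \<sigma>})"
  have "(\<chi> i. g i) \<in> convex hull P"
  proof (rule ccontr)
    assume out: "(\<chi> i. g i) \<notin> convex hull P"
    have "closed (convex hull P)"
      unfolding P_def by (intro compact_imp_closed finite_imp_compact_convex_hull) simp
    then obtain a b where ab: "inner a (\<chi> i. g i) < b" "\<And>x. x \<in> convex hull P \<Longrightarrow> b < inner a x"
      using separating_hyperplane_closed_point[OF convex_convex_hull _ out] by blast
    define w where "w i = \<bar>a $ i\<bar>" for i
    obtain \<sigma> where \<sigma>: "bij \<sigma>" "\<And>i j. w j < w i \<Longrightarrow> g (\<sigma> j) \<le> g (\<sigma> i)"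
      "(\<Sum>i\<in>UNIV. w i * g i) \<le> (\<Sum>i\<in>UNIV. w i * g (\<sigma> i))"
      using exists_monotone_rearrangement[of w g] by blast
    have inj: "inj_on \<sigma> S" for S using \<sigma>(1) by (meson bij_is_inj inj_on_subset subset_UNIV)
    have "0 \<le> (\<Sum>i\<in>UNIV. w i * (m (\<sigma> i) - g (\<sigma> i)))"
    proof (rule sum_mult_nonneg_of_levels)
      fix c :: real assume "0 < c"
      \<comment> \<open>Since \<sigma> orders \<open>g\<close> compatibly with \<open>w\<close>, it
        maps level sets of \<open>w\<close> to sets of largest entries of \<open>g\<close>, to which
        \<open>maj\<close> applies.\<close>
      have "sum g (\<sigma> ` {i. c \<le> w i}) \<le> sum m (\<sigma> ` {i. c \<le> w i})"
      proof (rule maj)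
        fix i j assume i: "i \<in> \<sigma> ` {i. c \<le> w i}" and j: "j \<notin> \<sigma> ` {i. c \<le> w i}"
        obtain j' where "j = \<sigma> j'" using \<sigma>(1) by (metis bij_pointE)
        with i j \<sigma>(2) show "g j \<le> g i" by force
      qed
      then show "0 \<le> (\<Sum>i | c \<le> w i. m (\<sigma> i) - g (\<sigma> i))"
        by (simp add: sum.reindex inj sum_subtractf)
    qed (simp add: w_def)
    then have le: "(\<Sum>i\<in>UNIV. w i * g i) \<le> (\<Sum>i\<in>UNIV. w i * m (\<sigma> i))"
      using \<sigma>(3) by (simp add: right_diff_distrib sum_subtractf)
    \<comment> \<open>The signs are opposite to those of \<open>a\<close>, so this vertex gives the
      functional its smallest value for the permutation \<sigma> when the entries of
      \<open>m\<close> are weighted by \<open>w\<close>.\<close>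
    have "f (\<lambda>i. a $ i \<le> 0) \<sigma> \<in> P" using \<sigma>(1) by (auto simp: P_def)
    then have "b < inner a (f (\<lambda>i. a $ i \<le> 0) \<sigma>)" by (intro ab hull_inc)
    also have "\<dots> = - (\<Sum>i\<in>UNIV. w i * m (\<sigma> i))"
      unfolding inner_vec_def sum_negf[symmetric] by (intro sum.cong) (auto simp: f_def w_def)
    also have "\<dots> \<le> - (\<Sum>i\<in>UNIV. w i * g i)" using le by simp
    also have "\<dots> \<le> inner a (\<chi> i. g i)"
      unfolding inner_vec_def sum_negf[symmetric]
    proof (intro sum_mono)
      fix i
      have "- a $ i * g i \<le> w i * g i" using g[of i] by (intro mult_right_mono) (auto simp: w_def)
      then show "- (w i * g i) \<le> inner (a $ i) ((\<chi> i. g i) $ i)" by simp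
    qed
    finally show False using ab(1) by simp
  qed
  \<comment> \<open>The signed permutations of \<open>m\<close> all have the norm of
    \<open>diag_mat m\<close>, and sublevel sets of a norm are convex.\<close>
  moreover have "convex hull P \<subseteq> {z. N (diag_mat (\<lambda>i. z $ i)) \<le> N (diag_mat m)}"
  proof (rule hull_minimal)
    show "P \<subseteq> {z. N (diag_mat (\<lambda>i. z $ i)) \<le> N (diag_mat m)}"
    proof -
      have "N (diag_mat (\<lambda>i. f s \<sigma> $ i)) = N (diag_mat m)" if "bij \<sigma>" for s \<sigma>
        using ui_norm_signed_perm[OF bij_is_inj[OF that], of "\<lambda>i. if s i then 1 else - 1" m]
        by (simp add: f_def vec_lambda_inverse)
      then show ?thesis by (auto simp: P_def)
    qed
    show "convex {z. N (diag_mat (\<lambda>i. z $ i)) \<le> N (diag_mat m)}"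
    proof (rule convexI, clarify)
      fix x y :: "real^'n" and u v :: real
      assume *: "N (diag_mat (\<lambda>i. x $ i)) \<le> N (diag_mat m)" "N (diag_mat (\<lambda>i. y $ i)) \<le> N (diag_mat m)"
        "0 \<le> u" "0 \<le> v" "u + v = 1"
      have "diag_mat (\<lambda>i. (u *\<^sub>R x + v *\<^sub>R y) $ i) =
          u *\<^sub>R diag_mat (\<lambda>i. x $ i) + v *\<^sub>R (diag_mat (\<lambda>i. y $ i) :: complex^'n^'n)"
        by (simp add: udiag_scaleR udiag_add flip: udiag_mat_1)
      then have "N (diag_mat (\<lambda>i. (u *\<^sub>R x + v *\<^sub>R y) $ i)) \<le>
          u * N (diag_mat (\<lambda>i. x $ i)) + v * N (diag_mat (\<lambda>i. y $ i))"
        using * by (metis ui_norm_add ui_norm_scaleR abs_of_nonneg)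
      also have "\<dots> \<le> N (diag_mat m)"
        using * by (intro convex_bound_le)
      finally show "N (diag_mat (\<lambda>i. (u *\<^sub>R x + v *\<^sub>R y) $ i)) \<le> N (diag_mat m)" .
    qed
  qed
  ultimately show ?thesis by auto
qed

text \<open>Averaging a matrix with its conjugate under the reflection that flips coordinate
  \<open>a\<close> deletes the off-diagonal entries in row and column \<open>a\<close> and does not
  increase the norm. Doing this for every index leaves the diagonal.\<close>

lemma ui_norm_pinching:
  assumes M: "hermitian M"
  shows "N (diag_mat (\<lambda>i. Re (M $ i $ i))) \<le> N M"
proof -
  define pinch where "pinch T = (\<chi> i j. if i \<noteq> j \<and> (i \<in> T \<or> j \<in> T) then 0 else M $ i $ j)" for T
  have "N (pinch T) \<le> N M" if "finite T" for T
    using that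
  proof (induction T)
    case empty
    then show ?case by (simp add: pinch_def vec_lambda_eta)
  next
    case (insert a T)
    let ?D = "diag_mat (\<lambda>i. if i = a then - 1 else 1) :: complex^'n^'n"
    have D: "unitary ?D"
      by (intro unitaryI) (simp add: diag_mat_mult diag_mat_one if_distrib cong: if_cong)
    have "pinch (insert a T) = (1/2) *\<^sub>R (pinch T + ?D ** pinch T ** ?D)"
      by (auto simp: vec_eq_iff pinch_def scaleR_conv_of_real[where 'a=complex])
    then have "N (pinch (insert a T)) \<le> (1/2) * (N (pinch T) + N (?D ** pinch T ** ?D))"
      by (simp add: ui_norm_scaleR ui_norm_add)
    also have "\<dots> = N (pinch T)" by (simp add: ui_norm_unitary D)
    finally show ?case using insert.IH by simp
  qed
  then have "N (pinch UNIV) \<le> N M" by simp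
  moreover have "Im (M $ i $ i) = 0" for i
    using arg_cong[of _ _ "\<lambda>X. Im (X $ i $ i)", OF M[unfolded hermitian_def]] by simp
  then have "pinch UNIV = diag_mat (\<lambda>i. Re (M $ i $ i))"
    by (simp add: pinch_def diag_mat_def vec_eq_iff complex_eq_iff)
  ultimately show ?thesis by simp
qed

text \<open>The diagonal \<open>m\<close> of \<open>mat_exp K\<close> in the basis \<open>U\<close>
  mediates between the two norms: it dominates the vector of all \<open>exp (h i)\<close> on sets of
  largest entries, and pinching bounds its norm by that of \<open>mat_exp K\<close>.\<close>

lemma ui_norm_mat_exp_le:
  assumes U: "unitary U" and K: "hermitian K"
    and maj: "\<And>S. (\<And>i j. i \<in> S \<Longrightarrow> j \<notin> S \<Longrightarrow> h j \<le> h i) \<Longrightarrow>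
      (\<Sum>i\<in>S. h i) \<le> (\<Sum>i\<in>S. Re ((adjoint_mat U ** K ** U) $ i $ i))"
  shows "N (mat_exp (udiag U h)) \<le> N (mat_exp K)"
proof -
  obtain V k where V: "unitary V" "K = udiag V k" using hermitian_eq_udiag[OF K] by blast
  define W where "W = adjoint_mat U ** V"
  have W: "unitary W" using U V by (simp add: W_def unitary_mult unitary_adjoint)
  have K': "adjoint_mat U ** K ** U = udiag W k" by (simp add: V(2) W_def udiag_conj')
  define y where "y i = Re (udiag W k $ i $ i)" for i
  define m where "m i = Re (udiag W (\<lambda>i. exp (k i)) $ i $ i)" for i
  \<comment> \<open>These are the squared moduli of the entries of \<open>W\<close>; each row is a
    probability distribution, so \<open>y i\<close> is a mean of the eigenvalues
    \<open>k l\<close>.\<close>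
  define p where "p i l = Re (W $ i $ l * cnj (W $ i $ l))" for i l
  have nth: "Re (udiag W d $ i $ i) = (\<Sum>l\<in>UNIV. d l * p i l)" for d i
    by (simp add: udiag_nth p_def)
  have p0: "0 \<le> p i l" for i l by (simp add: p_def)
  have p1: "(\<Sum>l\<in>UNIV. p i l) = 1" for i
    using nth[of "\<lambda>_. 1" i] by (simp add: udiag_one W mat_def)
  have tangent: "exp a * (1 + (b - a)) \<le> exp b" for a b :: real
    using mult_left_mono[OF exp_ge_add_one_self[of "b - a"], of "exp a"] by (simp flip: exp_add)
  \<comment> \<open>Jensen's inequality, by averaging the tangent to \<open>exp\<close> at the mean
    \<open>y i\<close>.\<close>
  have my: "exp (y i) \<le> m i" for i
  proof -
    have "exp (y i) = (\<Sum>l\<in>UNIV. exp (y i) * (1 + (k l - y i)) * p i l)"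
    proof -
      have "(\<Sum>l\<in>UNIV. exp (y i) * (1 + (k l - y i)) * p i l) =
          exp (y i) * ((1 - y i) * (\<Sum>l\<in>UNIV. p i l) + (\<Sum>l\<in>UNIV. k l * p i l))"
        by (simp add: sum_distrib_left sum.distrib[symmetric] algebra_simps)
      then show ?thesis by (simp add: p1 y_def nth)
    qed
    also have "\<dots> \<le> m i"
      unfolding m_def nth by (intro sum_mono mult_right_mono tangent p0)
    finally show ?thesis .
  qed
  have "N (mat_exp (udiag U h)) = N (diag_mat (\<lambda>i. exp (h i)))"
    by (simp add: mat_exp_udiag ui_norm_udiag U)
  also have "\<dots> \<le> N (diag_mat m)"
  proof (rule ui_norm_diag_le_of_majorized)
    fix S assume S: "\<And>i j. i \<in> S \<Longrightarrow> j \<notin> S \<Longrightarrow> exp (h j) \<le> exp (h i)"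
    \<comment> \<open>The positive level sets of \<open>w\<close> again consist of largest entries
      of \<open>h\<close>, so layer-cake summation passes from \<open>maj\<close> to the weighted
      sum. The tangents to \<open>exp\<close> at the points \<open>h i\<close> then pass to
      exponentials.\<close>
    define w where "w i = (if i \<in> S then exp (h i) else 0)" for i
    have "0 \<le> (\<Sum>i\<in>UNIV. w i * (y i - h i))"
    proof (rule sum_mult_nonneg_of_levels)
      fix c :: real assume c: "0 < c"
      have "(\<Sum>i | c \<le> w i. h i) \<le> (\<Sum>i | c \<le> w i. y i)"
        unfolding y_def K'[symmetric]
      proof (rule maj)
        fix i j assume "i \<in> {i. c \<le> w i}" "j \<notin> {i. c \<le> w i}"
        then have "i \<in> S" "j \<notin> S \<or> exp (h j) < c" "c \<le> exp (h i)"
          using c by (auto simp: w_def split: if_splits)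
        then have "exp (h j) \<le> exp (h i)" using S[of i j] by (metis less_imp_le order_trans)
        then show "h j \<le> h i" by simp
      qed
      then show "0 \<le> (\<Sum>i | c \<le> w i. y i - h i)" by (simp add: sum_subtractf)
    qed (simp add: w_def)
    moreover have "(\<Sum>i\<in>UNIV. w i * (y i - h i)) = (\<Sum>i\<in>S. exp (h i) * (y i - h i))"
      by (rule sum.mono_neutral_cong_right) (auto simp: w_def)
    ultimately have "0 \<le> (\<Sum>i\<in>S. exp (h i) * (y i - h i))" by simp
    then have "(\<Sum>i\<in>S. exp (h i)) \<le> (\<Sum>i\<in>S. exp (h i) * (1 + (y i - h i)))"
      by (simp add: distrib_left sum.distrib)
    also have "\<dots> \<le> (\<Sum>i\<in>S. m i)"
      by (intro sum_mono order_trans[OF tangent my])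
    finally show "(\<Sum>i\<in>S. exp (h i)) \<le> (\<Sum>i\<in>S. m i)" .
  qed simp
  also have "\<dots> \<le> N (udiag W (\<lambda>i. exp (k i)))"
    unfolding m_def by (intro ui_norm_pinching hermitian_udiag)
  also have "\<dots> = N (mat_exp K)"
    by (simp add: V mat_exp_udiag ui_norm_udiag W)
  finally show ?thesis .
qed

end

section \<open>The two inequalities\<close>

lemma hermitian_mat_ln: "pos_def A \<Longrightarrow> hermitian (mat_ln A)"
  by (metis pos_def_eq_udiag mat_ln_def matfun_udiag hermitian_udiag)

lemma hermitian_log_mean:
  "pos_def A \<Longrightarrow> pos_def B \<Longrightarrow> hermitian ((1 - t) *\<^sub>R mat_ln A + t *\<^sub>R mat_ln B)"
  using hermitian_mat_ln[of A] hermitian_mat_ln[of B]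
  by (simp add: hermitian_def adjoint_add adjoint_scaleR)

lemma mat_ln_unitary_conj:
  assumes "pos_def A" "unitary U"
  shows "mat_ln (adjoint_mat U ** A ** U) = adjoint_mat U ** mat_ln A ** U"
proof -
  obtain V a where V: "unitary V" "A = udiag V a" using pos_def_eq_udiag[OF assms(1)] by blast
  then show ?thesis
    using assms(2) by (simp add: mat_ln_def udiag_conj' matfun_udiag unitary_mult unitary_adjoint)
qed

lemma mat_add_mult: "(A + B) ** C = A ** C + B ** C"
  for A B C :: "complex^'n^'n"
  by (simp add: vec_eq_iff matrix_matrix_mult_def sum.distrib distrib_right)

lemma mat_mult_scaleR: "A ** (c *\<^sub>R B) = c *\<^sub>R (A ** B)" "(c *\<^sub>R A) ** B = c *\<^sub>R (A ** B)"
  for A B :: "complex^'n^'n"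
  by (simp_all add: vec_eq_iff matrix_matrix_mult_def scaleR_sum_right)

lemma pos_def_mat_powr: "pos_def A \<Longrightarrow> pos_def (mat_powr A p)"
  and mat_ln_mat_powr: "pos_def A \<Longrightarrow> mat_ln (mat_powr A p) = p *\<^sub>R mat_ln A"
proof -
  assume "pos_def A"
  then obtain U a where U: "unitary U" "A = udiag U a" "\<And>i. 0 < a i" using pos_def_eq_udiag by blast
  show "pos_def (mat_powr A p)"
    using U U(3)[THEN order_less_imp_not_eq2] by (simp add: mat_powr_def matfun_udiag pos_def_udiag_iff)
  show "mat_ln (mat_powr A p) = p *\<^sub>R mat_ln A"
    using U by (simp add: mat_powr_def mat_ln_def matfun_udiag udiag_scaleR ln_powr)
qed

text \<open>The logarithm of \<open>mat_powr A p\<close> is \<open>p\<close> times that of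
  \<open>A\<close>, so concavity at the \<open>p\<close>-th powers bounds the form of the log mean
  \<open>L\<close> by that of \<open>K\<close>, the logarithm of the power mean.\<close>

lemma norm_log_mean_le_power_mean:
  fixes A B :: "complex^'n^'n"
  assumes A: "pos_def A" and B: "pos_def B" and t: "0 \<le> t" "t \<le> 1" and p: "0 < p"
    and N: "unitarily_invariant_norm N"
  shows "N (mat_exp ((1 - t) *\<^sub>R mat_ln A + t *\<^sub>R mat_ln B))
           \<le> N (mat_powr ((1 - t) *\<^sub>R mat_powr A p + t *\<^sub>R mat_powr B p) (1 / p))"
proof -
  define Q where "Q = (1 - t) *\<^sub>R mat_powr A p + t *\<^sub>R mat_powr B p"
  have Q: "pos_def Q" unfolding Q_def by (intro pos_def_convex pos_def_mat_powr A B t)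
  define L where "L = (1 - t) *\<^sub>R mat_ln A + t *\<^sub>R mat_ln B"
  define K where "K = (1 / p) *\<^sub>R mat_ln Q"
  obtain R q where R: "unitary R" "Q = udiag R q" "\<And>i. 0 < q i" using pos_def_eq_udiag[OF Q] by blast
  have exp_K: "mat_exp K = mat_powr Q (1 / p)"
    using R less_imp_neq[OF R(3), THEN not_sym]
    by (simp add: K_def mat_ln_def mat_powr_def R(2) matfun_udiag udiag_scaleR mat_exp_udiag powr_def)
  have le: "inner v (L *v v) \<le> inner v (K *v v)" for v
  proof -
    have "p * inner v (L *v v) =
        (1 - t) * inner v (mat_ln (mat_powr A p) *v v) + t * inner v (mat_ln (mat_powr B p) *v v)"
      by (simp add: L_def mat_ln_mat_powr A B matrix_vector_mult_add_rdistrib scaleR_mult_vec inner_add_right)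
        (simp add: algebra_simps)
    also have "\<dots> \<le> inner v (mat_ln Q *v v)"
      unfolding Q_def by (intro mat_ln_concave pos_def_mat_powr A B t)
    finally show ?thesis
      using p by (simp add: K_def scaleR_mult_vec pos_le_divide_eq mult.commute)
  qed
  have "hermitian L" unfolding L_def by (intro hermitian_log_mean A B)
  then obtain U h where U: "unitary U" "L = udiag U h" by (rule hermitian_eq_udiag)
  have "N (mat_exp (udiag U h)) \<le> N (mat_exp K)"
  proof (rule ui_norm_mat_exp_le[OF N U(1)])
    show "hermitian K"
      using hermitian_mat_ln[OF Q] by (simp add: K_def hermitian_def adjoint_scaleR)
    fix S
    \<comment> \<open>The columns of \<open>U\<close> are the test vectors for both forms, so the
      comparison holds entry by entry.\<close>
    have "h i \<le> Re ((adjoint_mat U ** K ** U) $ i $ i)" for i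
    proof -
      have conj: "Re ((adjoint_mat U ** M ** U) $ i $ i) = inner (U *v axis i 1) (M *v (U *v axis i 1))" for M
        by (simp add: inner_mult_adjoint flip: inner_axis_mult matrix_vector_mul_assoc)
      have "adjoint_mat U ** L ** U = diag_mat h"
        using U(1) by (simp add: U(2) udiag_conj' unitaryD udiag_mat_1)
      then have "h i = Re ((adjoint_mat U ** L ** U) $ i $ i)"
        by (simp add: diag_mat_def)
      then show ?thesis using le by (simp add: conj)
    qed
    then show "(\<Sum>i\<in>S. h i) \<le> (\<Sum>i\<in>S. Re ((adjoint_mat U ** K ** U) $ i $ i))"
      by (intro sum_mono)
  qed
  then show ?thesis by (simp add: exp_K flip: U(2) L_def Q_def)
qed

text \<open>The two powers on the right have logarithms with vanishing \<open>t\<close>-mean. The matrix \<open>W\<close>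
  of the proof is the unitary factor of \<open>C\<^bsup>t/2\<^esup> A\<^bsup>1/2\<^esup>\<close>, where \<open>C = A\<^bsup>-1/2\<^esup> B A\<^bsup>-1/2\<^esup>\<close>.\<close>

lemma geom_mean_congruence:
  fixes A B :: "complex^'n^'n"
  assumes A: "pos_def A" and B: "pos_def B"
  shows "\<exists>(U :: complex^'n^'n) (E :: complex^'n^'n) g c. unitary U \<and> unitary E \<and> (\<forall>i. 0 < g i \<and> 0 < c i) \<and>
    geom_mean t A B = udiag U g \<and>
    adjoint_mat U ** A ** U =
      diag_mat (\<lambda>i. sqrt (g i)) ** udiag E (\<lambda>i. c i powr - t) ** diag_mat (\<lambda>i. sqrt (g i)) \<and>
    adjoint_mat U ** B ** U =
      diag_mat (\<lambda>i. sqrt (g i)) ** udiag E (\<lambda>i. c i powr (1 - t)) ** diag_mat (\<lambda>i. sqrt (g i))"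
proof -
  obtain P a where P: "unitary P" "A = udiag P a" "\<And>i. 0 < a i" using pos_def_eq_udiag[OF A] by blast
  have a0: "a i \<noteq> 0" for i using P(3)[of i] by simp
  define Ah where "Ah = udiag P (\<lambda>i. a i powr (1/2))"
  define Ai where "Ai = udiag P (\<lambda>i. a i powr (-1/2))"
  have AA: "Ah ** Ah = A" "Ah ** Ai = mat 1" "Ai ** Ah = mat 1"
    using P a0 by (simp_all add: Ah_def Ai_def udiag_mult udiag_one less_imp_le flip: powr_add)
  have powA: "mat_powr A (1/2) = Ah" "mat_powr A (-1/2) = Ai"
    using P by (simp_all add: Ah_def Ai_def mat_powr_def matfun_udiag)
  have adj: "adjoint_mat Ah = Ah" "adjoint_mat Ai = Ai" by (simp_all add: Ah_def Ai_def)
  define C where "C = Ai ** B ** Ai"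
  have "pos_def C"
    using pos_def_congruence[OF B AA(2)] by (simp add: C_def adj)
  then obtain R c where R: "unitary R" "C = udiag R c" "\<And>i. 0 < c i" using pos_def_eq_udiag by blast
  have c0: "c i \<noteq> 0" for i using R(3)[of i] by simp
  define F where "F r = udiag R (\<lambda>i. c i powr r)" for r
  have FF: "F r ** F s = F (r + s)" for r s
    using R(1) by (simp add: F_def udiag_mult powr_add)
  have F1: "F 1 = C" "F 0 = mat 1" using R c0 by (simp_all add: F_def udiag_one less_imp_le)
  have adjF: "adjoint_mat (F r) = F r" for r by (simp add: F_def)
  define G where "G = geom_mean t A B"
  have G: "G = Ah ** F t ** Ah"
    unfolding G_def geom_mean_def powA C_def[symmetric]
    using R by (simp add: mat_powr_def matfun_udiag F_def)
  \<comment> \<open>A factor with \<open>adjoint_mat Z ** Z = G\<close>. Inserting the power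
    \<open>F r\<close> in the middle shifts the exponent to \<open>r + t\<close>, so
    \<open>r = - t\<close> yields \<open>A\<close> and \<open>r = 1 - t\<close> yields
    \<open>B\<close>.\<close>
  define Z where "Z = F (t/2) ** Ah"
  define Z' where "Z' = Ai ** F (- t/2)"
  have ZF: "adjoint_mat Z ** F r ** Z = Ah ** F (r + t) ** Ah" for r
  proof -
    have "F (t/2) ** (F r ** (F (t/2) ** X)) = F (r + t) ** X" for X :: "complex^'n^'n"
      by (simp add: matrix_mul_assoc FF add_ac)
    then show ?thesis by (simp add: Z_def adjoint_mult adj adjF flip: matrix_mul_assoc)
  qed
  have ZA: "adjoint_mat Z ** F (- t) ** Z = A" "adjoint_mat Z ** F (1 - t) ** Z = B"
  proof -
    have "Ah ** C ** Ah = (Ah ** Ai) ** B ** (Ai ** Ah)"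
      by (simp add: C_def matrix_mul_assoc)
    then show "adjoint_mat Z ** F (- t) ** Z = A" "adjoint_mat Z ** F (1 - t) ** Z = B"
      by (simp_all add: ZF F1 AA)
  qed
  have ZG: "adjoint_mat Z ** Z = G"
    using ZF[of 0] by (simp add: F1 G)
  have "Z' ** Z = mat 1"
  proof -
    have "Z' ** Z = Ai ** (F (- t/2) ** F (t/2)) ** Ah"
      by (simp add: Z_def Z'_def matrix_mul_assoc)
    then show ?thesis by (simp add: FF F1 AA)
  qed
  moreover have "pos_def (mat 1 :: complex^'n^'n)"
    by (simp add: pos_def_iff_inner hermitian_def)
  ultimately have "pos_def G"
    using pos_def_congruence[of "mat 1" Z' Z] by (simp add: ZG)
  then obtain U g where U: "unitary U" "G = udiag U g" "\<And>i. 0 < g i" using pos_def_eq_udiag by blast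
  define D where "D = (diag_mat (\<lambda>i. sqrt (g i)) :: complex^'n^'n)"
  define D' where "D' = (diag_mat (\<lambda>i. 1 / sqrt (g i)) :: complex^'n^'n)"
  have DD: "D' ** D = mat 1" "D' ** diag_mat g ** D' = mat 1"
    using U(3) less_imp_neq[OF U(3), THEN not_sym]
    by (simp_all add: D_def D'_def diag_mat_mult abs_of_pos flip: diag_mat_one)
  have adjD: "adjoint_mat D' = D'" "adjoint_mat D = D" by (simp_all add: D_def D'_def)
  \<comment> \<open>The columns of \<open>Z ** U\<close> are orthogonal with squared lengths
    \<open>g i\<close>; the factor \<open>D'\<close> normalises them.\<close>
  define W where "W = Z ** U ** D'"
  have "adjoint_mat W ** W = D' ** (adjoint_mat U ** (adjoint_mat Z ** Z) ** U) ** D'"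
    by (simp add: W_def adjoint_mult adjD matrix_mul_assoc)
  also have "adjoint_mat U ** (adjoint_mat Z ** Z) ** U = diag_mat g"
    using U(1) by (simp add: ZG U(2) udiag_conj' unitaryD udiag_mat_1)
  finally have W: "unitary W" by (intro unitaryI) (simp add: DD)
  have ZW: "Z ** U = W ** D"
  proof -
    have "W ** D = Z ** U ** (D' ** D)" by (simp add: W_def matrix_mul_assoc)
    then show ?thesis by (simp add: DD)
  qed
  define E where "E = adjoint_mat W ** R"
  have E: "unitary E" using W R by (simp add: E_def unitary_mult unitary_adjoint)
  have conj: "adjoint_mat U ** (adjoint_mat Z ** F r ** Z) ** U = D ** udiag E (\<lambda>i. c i powr r) ** D" for r
  proof -
    have "adjoint_mat U ** (adjoint_mat Z ** F r ** Z) ** U = adjoint_mat (Z ** U) ** F r ** (Z ** U)"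
      by (simp add: adjoint_mult matrix_mul_assoc)
    also have "\<dots> = D ** (adjoint_mat W ** F r ** W) ** D"
      by (simp add: ZW adjoint_mult adjD matrix_mul_assoc)
    finally show ?thesis by (simp add: F_def E_def udiag_conj')
  qed
  show ?thesis
    using U(1) E U(3) R(3) U(2) conj[of "- t"] conj[of "1 - t"]
    unfolding ZA G_def D_def by blast
qed

text \<open>The norm comparison is applied to the logarithm of the geometric mean in its eigenbasis
  \<open>U\<close>. Its hypothesis is the weighted sum of the bounds from
  \<open>sum_mat_ln_diag_congruence_ge\<close> for \<open>A\<close> and \<open>B\<close>.\<close>

lemma norm_geom_mean_le_log_mean:
  fixes A B :: "complex^'n^'n"
  assumes A: "pos_def A" and B: "pos_def B" and t: "0 \<le> t" "t \<le> 1"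
    and N: "unitarily_invariant_norm N"
  shows "N (geom_mean t A B) \<le> N (mat_exp ((1 - t) *\<^sub>R mat_ln A + t *\<^sub>R mat_ln B))"
proof -
  obtain U E :: "complex^'n^'n" and g c where U: "unitary U" and E: "unitary E"
    and g: "\<And>i. 0 < g i" and c: "\<And>i. 0 < c i" and G: "geom_mean t A B = udiag U g"
    and UA: "adjoint_mat U ** A ** U =
      diag_mat (\<lambda>i. sqrt (g i)) ** udiag E (\<lambda>i. c i powr - t) ** diag_mat (\<lambda>i. sqrt (g i))"
    and UB: "adjoint_mat U ** B ** U =
      diag_mat (\<lambda>i. sqrt (g i)) ** udiag E (\<lambda>i. c i powr (1 - t)) ** diag_mat (\<lambda>i. sqrt (g i))"
    using geom_mean_congruence[OF A B, of t] by blast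
  have c0: "c i \<noteq> 0" for i using c[of i] by simp
  define L where "L = (1 - t) *\<^sub>R mat_ln A + t *\<^sub>R mat_ln B"
  define l where "l M i = Re ((adjoint_mat U ** M ** U) $ i $ i)" for M i
  define e where "e r i = Re (mat_ln (udiag E (\<lambda>i. c i powr r)) $ i $ i)" for r i
  have pE: "pos_def (udiag E (\<lambda>i. c i powr r))" for r
    using c0 by (simp add: pos_def_udiag_iff E)
  \<comment> \<open>The powers share the eigenbasis \<open>E\<close>, so their logarithms are
    multiples of a single matrix.\<close>
  have e: "e r i = r * e 1 i" for r i
    using c c0 by (simp add: e_def mat_ln_def matfun_udiag E ln_powr less_imp_le flip: udiag_scaleR)
  have lL: "l L i = (1 - t) * l (mat_ln A) i + t * l (mat_ln B) i" for i
    by (simp add: l_def L_def matrix_add_ldistrib mat_add_mult mat_mult_scaleR)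
  have "N (mat_exp (udiag U (\<lambda>i. ln (g i)))) \<le> N (mat_exp L)"
  proof (rule ui_norm_mat_exp_le[OF N U])
    show "hermitian L" unfolding L_def by (intro hermitian_log_mean A B)
    fix S assume "\<And>i j. i \<in> S \<Longrightarrow> j \<notin> S \<Longrightarrow> ln (g j) \<le> ln (g i)"
    then have S: "g j \<le> g i" if "i \<in> S" "j \<notin> S" for i j
      using that g by simp
    have "(\<Sum>i\<in>S. ln (g i) + e (- t) i) \<le> (\<Sum>i\<in>S. l (mat_ln A) i)"
      using sum_mat_ln_diag_congruence_ge[OF pE[of "- t"] g S]
      by (simp add: l_def e_def mat_ln_unitary_conj[OF A U, symmetric] UA)
    moreover have "(\<Sum>i\<in>S. ln (g i) + e (1 - t) i) \<le> (\<Sum>i\<in>S. l (mat_ln B) i)"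
      using sum_mat_ln_diag_congruence_ge[OF pE[of "1 - t"] g S]
      by (simp add: l_def e_def mat_ln_unitary_conj[OF B U, symmetric] UB)
    ultimately have "(1 - t) * (\<Sum>i\<in>S. ln (g i) + e (- t) i) + t * (\<Sum>i\<in>S. ln (g i) + e (1 - t) i) \<le>
      (1 - t) * (\<Sum>i\<in>S. l (mat_ln A) i) + t * (\<Sum>i\<in>S. l (mat_ln B) i)"
      using t by (intro add_mono mult_left_mono) auto
    \<comment> \<open>The total coefficient of \<open>e 1 i\<close> is
      \<open>(1 - t) * (- t) + t * (1 - t)\<close>, which is 0.\<close>
    moreover have "(1 - t) * (ln (g i) + e (- t) i) + t * (ln (g i) + e (1 - t) i) = ln (g i)" for i
      unfolding e[of "- t" i] e[of "1 - t" i] by (simp add: algebra_simps)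
    then have "(1 - t) * (\<Sum>i\<in>S. ln (g i) + e (- t) i) + t * (\<Sum>i\<in>S. ln (g i) + e (1 - t) i) =
      (\<Sum>i\<in>S. ln (g i))"
      unfolding sum_distrib_left sum.distrib[symmetric] by simp
    moreover have "(1 - t) * (\<Sum>i\<in>S. l (mat_ln A) i) + t * (\<Sum>i\<in>S. l (mat_ln B) i) = (\<Sum>i\<in>S. l L i)"
      by (simp add: lL sum_distrib_left sum.distrib)
    ultimately show "(\<Sum>i\<in>S. ln (g i)) \<le> (\<Sum>i\<in>S. Re ((adjoint_mat U ** L ** U) $ i $ i))"
      by (simp add: l_def)
  qed
  then show ?thesis
    using g by (simp add: mat_exp_udiag U G flip: L_def)
qed

theorem corollary2:
  fixes A B :: "complex^'n^'n" and t p :: real and N :: "complex^'n^'n \<Rightarrow> real"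
  assumes "pos_def A" and "pos_def B"
    and "0 \<le> t" and "t \<le> 1"
    and "p > 0"
    and "unitarily_invariant_norm N"
  shows "N (geom_mean t A B) \<le> N (mat_exp ((1 - t) *\<^sub>R mat_ln A + t *\<^sub>R mat_ln B)) \<and>
         N (mat_exp ((1 - t) *\<^sub>R mat_ln A + t *\<^sub>R mat_ln B))
           \<le> N (mat_powr ((1 - t) *\<^sub>R mat_powr A p + t *\<^sub>R mat_powr B p) (1 / p))"
  using assms norm_geom_mean_le_log_mean norm_log_mean_le_power_mean by blast

end
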